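(* For all $\xi,\eta,\xi_0,\eta_0\in\mathbb{R}$ with $\eta>|\eta_0|$, $$K_0\bigl(r(\xi,\eta,\xi_0,\eta_0)\bigr)=\sqrt{\pi}\,e^{(\eta_0^2-\xi_0^2-\eta^2-\xi^2)/2}\sum_{n=0}^\infty \frac{(-i)^n}{2^{n-1}\,n!}\,H_n(\xi)\,H_{-n-1}(\eta)\,H_n(\xi_0)\,H_n(i\eta_0),$$ where $r=r(\xi,\eta,\xi_0,\eta_0)>0$ is defined by $$r^2=\tfrac14\left[(\xi+\xi_0)^2+(\eta+\eta_0)^2\right]\left[(\xi-\xi_0)^2+(\eta-\eta_0)^2\right].$$
   Context: $K_0(z)=\int_0^\infty e^{-z\cosh t}\,dt$ for $z>0$ is the modified Bessel function of the second kind of order $0$. Kummer's function is $M(a,b,z)=\sum_{n=0}^\infty \frac{(a)_n z^n}{(b)_n n!}$, with $(a)_n$ the Pochhammer symbol. For $\nu,z\in\mathbb{C}$ the Hermite function is $$H_\nu(z)=\frac{2^\nu\sqrt{\pi}}{\Gamma\left(\frac{1-\nu}{2}\right)}M\left(-\frac{\nu}{2},\frac12,z^2\right)-\frac{2^{\nu+1}\sqrt{\pi}}{\Gamma\left(-\frac{\nu}{2}\right)}\,z\,M\left(\frac{1-\nu}{2},\frac32,z^2\right),$$ with $1/\Gamma$ understood as an entire function. For $\nu=n\in\{0,1,2,\dots\}$ it is the (physicists') Hermite polynomial of degree $n$. *)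

theory Defs
  imports "HOL-Analysis.Analysis"
begin

definition bessel_K0 :: "real \<Rightarrow> real" where
  "bessel_K0 z = (LBINT t:{0..}. exp (- z * cosh t))"

definition kummer_M :: "complex \<Rightarrow> complex \<Rightarrow> complex \<Rightarrow> complex" where
  "kummer_M a b z = (\<Sum>n. pochhammer a n * z ^ n / (pochhammer b n * fact n))"

text \<open>The library's \<^const>\<open>rGamma\<close> is the entire extension of the reciprocal of
  \<^const>\<open>Gamma\<close>, so the definition is valid for all \<open>\<nu>\<close>, including those for which one of the
  two Gamma factors has a pole.\<close>

definition hermite_H :: "complex \<Rightarrow> complex \<Rightarrow> complex" where
  "hermite_H \<nu> z =
     2 powr \<nu> * of_real (sqrt pi) * rGamma ((1 - \<nu>) / 2) * kummer_M (- \<nu> / 2) (1/2) (z\<^sup>2)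
     - 2 powr (\<nu> + 1) * of_real (sqrt pi) * rGamma (- \<nu> / 2) * z
         * kummer_M ((1 - \<nu>) / 2) (3/2) (z\<^sup>2)"

definition parabolic_r :: "real \<Rightarrow> real \<Rightarrow> real \<Rightarrow> real \<Rightarrow> real" where
  "parabolic_r \<xi> \<eta> \<xi>0 \<eta>0 =
     sqrt (1/4 * ((\<xi> + \<xi>0)\<^sup>2 + (\<eta> + \<eta>0)\<^sup>2) * ((\<xi> - \<xi>0)\<^sup>2 + (\<eta> - \<eta>0)\<^sup>2))"

end

theory Submission
  imports Defs "HOL-Probability.Probability"
begin

text \<open>
  Write \<open>r\<^sup>2 = A B / 4\<close> with \<open>A = (\<xi> + \<xi>0)\<^sup>2 + (\<eta> + \<eta>0)\<^sup>2\<close> and \<open>B = (\<xi> - \<xi>0)\<^sup>2 + (\<eta> - \<eta>0)\<^sup>2\<close>. Then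
  \<open>K\<^sub>0(r) = \<integral> exp (- (A exp (- 2\<theta>) + B exp (2\<theta>)) / 4) d\<theta>\<close> over the real line, and the integrand separates
  into a \<open>\<xi>\<close>-part and an \<open>\<eta>\<close>-part. Up to constants the \<open>\<xi>\<close>-part is
  \<open>1 / cosh \<theta>\<close> times Mehler's kernel at \<open>\<rho> = tanh \<theta>\<close>; expanding the kernel leaves the moments of \<open>tanh \<theta>\<close> against
  \<open>exp (- (\<eta> sinh \<theta> - \<eta>0 cosh \<theta>)\<^sup>2) / cosh \<theta>\<close>. The zeroth moment depends on \<open>\<eta>\<close> alone, by a hyperbolic shift
  and symmetrisation. The generating function of all moments reduces to the zeroth one by a further
  shift by \<open>artanh z\<close>, and comparing its coefficients with those of
  \<open>\<integral> exp (2 \<eta>0 z t + z\<^sup>2 t\<^sup>2 - t\<^sup>2 - 2 \<eta> t) dt\<close> over the positive half-line identifies the \<open>n\<close>-th moment as a multiple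
  of \<open>H\<^sub>n(\<i> \<eta>0) H\<^bsub>-n-1\<^esub>(\<eta>)\<close>.
\<close>

subsection \<open>Series and Hermite coefficients\<close>

text \<open>The constant term is the limit of the sum at 0; removing it and dividing by
  \<open>x\<close> shifts the series, so the coefficients can be compared one after another. This is
  the tool for every comparison of generating functions below.\<close>

lemma powser_sums_unique:
  fixes a b :: "nat \<Rightarrow> 'a::{real_normed_field,banach}"
  assumes "0 < r"
    and a: "\<And>x. norm x < r \<Longrightarrow> (\<lambda>n. a n * x ^ n) sums f x"
    and b: "\<And>x. norm x < r \<Longrightarrow> (\<lambda>n. b n * x ^ n) sums f x"
  shows "a = b"
proof -
  have shift: "(\<lambda>n. c (Suc n) * x ^ n) sums ((g x - c 0) / x)"
    if "x \<noteq> 0" "(\<lambda>n. c n * x ^ n) sums g x" for c :: "nat \<Rightarrow> 'a" and g x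
  proof -
    have "(\<lambda>n. c (Suc n) * x ^ Suc n) sums (g x - c 0)"
      using that(2) sums_Suc_iff[of "\<lambda>n. c n * x ^ n" "g x - c 0"] by simp
    from sums_divide[OF this, of x] show ?thesis using that(1) by (simp add: field_simps)
  qed
  \<comment> \<open>Division by \<open>x\<close> loses the point 0, so the induction carries a
    common sum \<open>g\<close> of both tails only for \<open>x\<close> different from 0. The limit
    along \<open>at 0\<close> does not see the missing point.\<close>
  have "a n = b n \<and> (\<exists>g. \<forall>x. x \<noteq> 0 \<longrightarrow> norm x < r \<longrightarrow>
          (\<lambda>k. a (Suc n + k) * x ^ k) sums g x \<and> (\<lambda>k. b (Suc n + k) * x ^ k) sums g x)" for n
  proof -
    have step: "a n = b n \<and> (\<forall>x. x \<noteq> 0 \<longrightarrow> norm x < r \<longrightarrow>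
          (\<lambda>k. a (Suc n + k) * x ^ k) sums ((g x - a n) / x) \<and>
          (\<lambda>k. b (Suc n + k) * x ^ k) sums ((g x - a n) / x))"
      if g: "\<forall>x. x \<noteq> 0 \<longrightarrow> norm x < r \<longrightarrow>
          (\<lambda>k. a (n + k) * x ^ k) sums g x \<and> (\<lambda>k. b (n + k) * x ^ k) sums g x" for n g
    proof -
      have "(g \<longlongrightarrow> a (n + 0)) (at 0)"
        by (rule powser_limit_0_strong[OF \<open>0 < r\<close>]) (use g in auto)
      moreover have "(g \<longlongrightarrow> b (n + 0)) (at 0)"
        by (rule powser_limit_0_strong[OF \<open>0 < r\<close>]) (use g in auto)
      ultimately have "a n = b n"
        by (intro tendsto_unique[of "at (0::'a)"]) auto
      then show ?thesis
        using g shift[of _ "\<lambda>k. a (n + k)" g] shift[of _ "\<lambda>k. b (n + k)" g] by simp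
    qed
    show ?thesis
    proof (induction n)
      case 0
      have "\<forall>x. x \<noteq> 0 \<longrightarrow> norm x < r \<longrightarrow>
          (\<lambda>k. a (0 + k) * x ^ k) sums f x \<and> (\<lambda>k. b (0 + k) * x ^ k) sums f x"
        using a b by auto
      from step[OF this] show ?case by (intro conjI exI[of _ "\<lambda>x. (f x - a 0) / x"]) auto
    next
      case (Suc n)
      then obtain g where "\<forall>x. x \<noteq> 0 \<longrightarrow> norm x < r \<longrightarrow>
          (\<lambda>k. a (Suc n + k) * x ^ k) sums g x \<and> (\<lambda>k. b (Suc n + k) * x ^ k) sums g x"
        by blast
      from step[OF this] show ?case by (intro conjI exI[of _ "\<lambda>x. (g x - a (Suc n)) / x"]) auto
    qed
  qed
  then show ?thesis by blast
qed

text \<open>One integrable bound \<open>w\<close> on the sums of the norms bounds all partial sums,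
  hence makes the integrals of the norms summable, which is what interchanging sum and integral
  requires. Every such interchange below goes through this lemma.\<close>

lemma
  fixes f :: "nat \<Rightarrow> 'a \<Rightarrow> 'b::{banach,second_countable_topology}"
  assumes [measurable]: "\<And>i. f i \<in> borel_measurable M"
    and w: "integrable M w"
    and sm: "\<And>x. x \<in> space M \<Longrightarrow> summable (\<lambda>i. norm (f i x))"
    and le: "\<And>x. x \<in> space M \<Longrightarrow> (\<Sum>i. norm (f i x)) \<le> w x"
  shows dominated_series_sums: "(\<lambda>i. integral\<^sup>L M (f i)) sums (\<integral>x. (\<Sum>i. f i x) \<partial>M)"
    and dominated_series_integrable_suminf: "integrable M (\<lambda>x. \<Sum>i. f i x)"
    and dominated_series_summable: "summable (\<lambda>i. norm (integral\<^sup>L M (f i)))"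
proof -
  have part: "(\<Sum>i<n. norm (f i x)) \<le> w x" if "x \<in> space M" for n x
    using sum_le_suminf[OF sm[OF that], of "{..<n}"] le[OF that] by auto
  have i: "integrable M (f i)" for i
  proof (rule Bochner_Integration.integrable_bound[OF w])
    show "AE x in M. norm (f i x) \<le> norm (w x)"
    proof (rule AE_I2)
      fix x assume x: "x \<in> space M"
      have "norm (f i x) \<le> (\<Sum>i<Suc i. norm (f i x))" by (simp add: sum_nonneg)
      also have "\<dots> \<le> w x" by (rule part[OF x])
      finally show "norm (f i x) \<le> norm (w x)" by simp
    qed
  qed simp
  have s: "summable (\<lambda>i. \<integral>x. norm (f i x) \<partial>M)"
  proof (rule summableI_nonneg_bounded)
    fix n
    have "(\<Sum>i<n. \<integral>x. norm (f i x) \<partial>M) = (\<integral>x. (\<Sum>i<n. norm (f i x)) \<partial>M)"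
      using i by (subst Bochner_Integration.integral_sum) auto
    also have "\<dots> \<le> integral\<^sup>L M w"
      using i w part by (intro integral_mono) auto
    finally show "(\<Sum>i<n. \<integral>x. norm (f i x) \<partial>M) \<le> integral\<^sup>L M w" .
  qed simp
  show "(\<lambda>i. integral\<^sup>L M (f i)) sums (\<integral>x. (\<Sum>i. f i x) \<partial>M)"
    by (rule sums_integral) (use i s sm in auto)
  show "integrable M (\<lambda>x. \<Sum>i. f i x)"
    by (rule integrable_suminf) (use i s sm in auto)
  show "summable (\<lambda>i. norm (integral\<^sup>L M (f i)))"
    by (rule summable_comparison_test_ev[OF _ s]) (use integral_norm_bound in auto)
qed

text \<open>Transfers the substitution rule for absolute integrability over sets to Bochner
  integrals over \<open>lborel\<close>, value and integrability together. Borel measurability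
  permits the passage between \<open>lborel\<close> and its completion.\<close>

lemma lborel_change_of_variables:
  fixes f g h :: "real \<Rightarrow> real"
  assumes S: "S \<in> sets borel"
    and T: "g ` S \<in> sets borel"
    and [measurable]: "f \<in> borel_measurable borel" "g \<in> borel_measurable borel"
       "h \<in> borel_measurable borel"
    and der: "\<And>x. x \<in> S \<Longrightarrow> (g has_field_derivative h x) (at x within S)"
    and inj: "inj_on g S"
  shows "has_bochner_integral lborel (\<lambda>x. indicator S x * (\<bar>h x\<bar> * f (g x))) b \<longleftrightarrow>
         has_bochner_integral lborel (\<lambda>y. indicator (g ` S) y * f y) b"
proof -
  note [measurable] = S T
  \<comment> \<open>Dictionary between the two notions of integral, used once for \<open>S\<close>
    and once for its image.\<close>
  have conv: "has_bochner_integral lborel (\<lambda>x. indicator A x * k x) b \<longleftrightarrow>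
      k absolutely_integrable_on A \<and> integral A k = b"
    if [measurable]: "A \<in> sets borel" "k \<in> borel_measurable borel" for A and k :: "real \<Rightarrow> real"
  proof -
    have 1: "integrable lborel (\<lambda>x. indicator A x * k x) \<longleftrightarrow> k absolutely_integrable_on A"
      unfolding set_integrable_def by (subst integrable_completion) auto
    have 2: "integral\<^sup>L lborel (\<lambda>x. indicator A x * k x) = integral A k"
      if "k absolutely_integrable_on A"
      using set_lebesgue_integral_eq_integral(2)[OF that]
      unfolding set_lebesgue_integral_def by (subst (asm) integral_completion) auto
    show ?thesis using 1 2 by (auto simp: has_bochner_integral_iff)
  qed
  show ?thesis
    using has_absolute_integral_change_of_variables_1'[of S g h f b] S der inj
    by (subst (1 2) conv) auto
qed

section \<open>Rescaled Hermite polynomials and their generating function\<close>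

text \<open>The parameter covers both cases needed: \<open>c = -1\<close> gives \<open>H\<^sub>n(z) / n!\<close>, and \<open>c = 1\<close> gives
  \<open>(-\<i>)\<^sup>n H\<^sub>n(\<i> z) / n!\<close>, which is real for real \<open>z\<close>.\<close>

definition hermite_coeff :: "'a::{real_normed_field,banach} \<Rightarrow> nat \<Rightarrow> 'a \<Rightarrow> 'a" where
  "hermite_coeff c n z =
     (\<Sum>k\<le>n. (if even k then c ^ (k div 2) / fact (k div 2) else 0) * ((2 * z) ^ (n - k) / fact (n - k)))"

lemma exp_square_sums:
  fixes c s :: "'a::{real_normed_field,banach}"
  shows "(\<lambda>k. (if even k then c ^ (k div 2) / fact (k div 2) else 0) * s ^ k) sums exp (c * s\<^sup>2)"
proof -
  have "(\<lambda>m. (c * s\<^sup>2) ^ m / fact m) sums exp (c * s\<^sup>2)"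
    using exp_converges[of "c * s\<^sup>2"] by (simp add: scaleR_conv_of_real field_simps)
  also have "(\<lambda>m. (c * s\<^sup>2) ^ m / fact m) =
      (\<lambda>m. (\<lambda>k. (if even k then c ^ (k div 2) / fact (k div 2) else 0) * s ^ k) (2 * m))"
    by (auto simp: power_mult_distrib power_mult)
  finally show ?thesis
    by (subst (asm) sums_mono_reindex) (auto simp: strict_mono_def elim!: evenE)
qed

lemma norm_exp_square_summable:
  fixes c s :: "'a::{real_normed_field,banach}"
  shows "summable (\<lambda>k. norm ((if even k then c ^ (k div 2) / fact (k div 2) else 0) * s ^ k))"
proof -
  have "(\<lambda>k. norm ((if even k then c ^ (k div 2) / fact (k div 2) else 0) * s ^ k)) =
     (\<lambda>k. (if even k then norm c ^ (k div 2) / fact (k div 2) else 0) * norm s ^ k)"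
    by (auto simp: norm_mult norm_power norm_divide)
  then show ?thesis
    using exp_square_sums[of "norm c" "norm s"] by (simp add: sums_iff)
qed

text \<open>\<open>hermite_coeff\<close> is by definition the Cauchy product of the series of
  \<open>exp (c * s^2)\<close> and \<open>exp (2 * z * s)\<close>. This identifies its generating
  function.\<close>

lemma hermite_coeff_sums:
  fixes c s z :: "'a::{real_normed_field,banach}"
  shows "(\<lambda>n. hermite_coeff c n z * s ^ n) sums exp (2 * z * s + c * s\<^sup>2)"
proof -
  let ?a = "\<lambda>k. (if even k then c ^ (k div 2) / fact (k div 2) else 0) * s ^ k"
  let ?b = "\<lambda>k. (2 * z * s) ^ k / fact k"
  have b: "?b sums exp (2 * z * s)"
    using exp_converges[of "2 * z * s"] by (simp add: scaleR_conv_of_real field_simps)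
  have "summable (\<lambda>k. norm (?b k))"
    using summable_norm_exp[of "2 * z * s"] by (simp add: scaleR_conv_of_real field_simps norm_divide norm_mult)
  then have "(\<lambda>n. \<Sum>k\<le>n. ?a k * ?b (n - k)) sums (suminf ?a * suminf ?b)"
    by (intro Cauchy_product_sums norm_exp_square_summable)
  moreover have "(\<Sum>k\<le>n. ?a k * ?b (n - k)) = hermite_coeff c n z * s ^ n" for n
    unfolding hermite_coeff_def sum_distrib_right
    by (intro sum.cong refl) (auto simp: power_mult_distrib power_add[symmetric])
  ultimately show ?thesis
    using b exp_square_sums[of c s] by (simp add: sums_iff exp_add mult.commute)
qed

lemma norm_hermite_coeff_le:
  fixes c z :: "'a::{real_normed_field,banach}"
  shows "norm (hermite_coeff c n z) \<le> hermite_coeff (norm c) n (norm z)"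
  unfolding hermite_coeff_def
  by (rule sum_norm_le) (auto simp: norm_mult norm_power norm_divide)

text \<open>Replacing \<open>c\<close>, \<open>z\<close> and \<open>s\<close> by their norms
  dominates the series termwise, and the dominating series is again a generating function with known
  sum. The resulting bound supplies the integrable majorants later.\<close>

lemma
  fixes c s z :: "'a::{real_normed_field,banach}"
  shows hermite_coeff_norm_summable: "summable (\<lambda>n. norm (hermite_coeff c n z * s ^ n))"
    and hermite_coeff_norm_suminf_le:
      "(\<Sum>n. norm (hermite_coeff c n z * s ^ n)) \<le> exp (2 * norm z * norm s + norm c * (norm s)\<^sup>2)"
proof -
  have le: "norm (hermite_coeff c n z * s ^ n) \<le> hermite_coeff (norm c) n (norm z) * norm s ^ n" for n
    by (simp add: norm_mult norm_power mult_right_mono norm_hermite_coeff_le)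
  note s = hermite_coeff_sums[of "norm c" "norm z" "norm s"]
  show sm: "summable (\<lambda>n. norm (hermite_coeff c n z * s ^ n))"
    by (rule summable_comparison_test_ev[OF _ sums_summable[OF s]]) (use le in auto)
  show "(\<Sum>n. norm (hermite_coeff c n z * s ^ n)) \<le> exp (2 * norm z * norm s + norm c * (norm s)\<^sup>2)"
    using suminf_le[OF le sm sums_summable[OF s]] s by (simp add: sums_iff)
qed

lemma hermite_coeff_of_real:
  "hermite_coeff (of_real c) n (of_real x :: 'a::{real_normed_field,banach}) = of_real (hermite_coeff c n x)"
  by (auto simp: hermite_coeff_def intro!: sum.cong)

text \<open>Only even \<open>k\<close> contribute. There \<open>(-\<i>)^k\<close> equals
  \<open>(-1)^(k div 2)\<close> and cancels the sign coming from \<open>c = -1\<close>, while each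
  remaining factor is \<open>(-\<i>) * (2 * \<i> * y) = 2 * y\<close>.\<close>

lemma hermite_coeff_imaginary:
  "(- \<i>) ^ n * hermite_coeff (-1) n (\<i> * of_real y) = of_real (hermite_coeff 1 n y)"
proof -
  have "(- \<i>) ^ n * ((if even k then (-1) ^ (k div 2) / fact (k div 2) else 0) *
          ((2 * (\<i> * of_real y)) ^ (n - k) / fact (n - k))) =
        of_real ((if even k then 1 ^ (k div 2) / fact (k div 2) else 0) * ((2 * y) ^ (n - k) / fact (n - k)))"
    if "k \<le> n" for k
  proof (cases "even k")
    case True
    then obtain m where m: "k = 2 * m" by (elim evenE)
    have "(- \<i>) ^ n = (- \<i>) ^ k * (- \<i>) ^ (n - k)"
      using that by (simp add: power_add[symmetric])
    moreover have "(- \<i>) ^ k = (-1) ^ m" by (simp add: m power_mult)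
    moreover have "(- \<i>) ^ (n - k) * (2 * (\<i> * of_real y)) ^ (n - k) = (2 * of_real y) ^ (n - k)"
    proof -
      have "(- \<i>) * (2 * (\<i> * of_real y)) = 2 * of_real y" by (simp add: complex_eq_iff)
      then show ?thesis by (metis power_mult_distrib)
    qed
    moreover have "(-1) ^ m * (-1) ^ m = (1::complex)"
      by (subst power_mult_distrib[symmetric]) simp
    moreover have "a * (e / f * (c / g)) = 1 / f * (d / g)"
      if "a = e' * b" "e' = e" "b * c = d" "e * e = 1" for a b c d e e' f g :: complex
    proof -
      have "a * (e / f * (c / g)) = (e * e) * (b * c) / (f * g)"
        unfolding that(1,2) by (simp add: ac_simps)
      then show ?thesis using that by simp
    qed
    ultimately have "(- \<i>) ^ n * ((-1) ^ m / fact m * ((2 * (\<i> * of_real y)) ^ (n - k) / fact (n - k))) =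
        1 / fact m * ((2 * of_real y) ^ (n - k) / fact (n - k))"
      by blast
    then show ?thesis by (simp add: m)
  qed simp
  then show ?thesis
    unfolding hermite_coeff_def sum_distrib_left of_real_sum by (intro sum.cong) auto
qed

subsection \<open>Hermite functions of nonnegative integer order\<close>

lemma pochhammer_neg_of_nat_mult_fact:
  fixes m j :: nat
  assumes "j \<le> m"
  shows "pochhammer (- of_nat m) j * fact (m - j) = (-1) ^ j * (fact m :: 'a::field_char_0)"
proof -
  have "fact m = (pochhammer 1 (m - j) * pochhammer (1 + of_nat (m - j)) j :: 'a)"
    using assms pochhammer_product'[of "1 :: 'a" "m - j" j] by (simp add: pochhammer_fact)
  moreover have "pochhammer (- of_nat m) j = ((-1) ^ j :: 'a) * pochhammer (1 + of_nat (m - j)) j"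
    using assms by (simp add: pochhammer_minus of_nat_diff algebra_simps)
  ultimately show ?thesis by (simp add: pochhammer_fact)
qed

lemma fact_double_Suc:
  "fact (2 * n + 1) = (4 ^ n * pochhammer (3 / 2) n * fact n :: 'a::field_char_0)"
  by (induction n) (simp_all add: pochhammer_Suc field_simps)

lemma pochhammer_half_eq: "pochhammer (1 / 2) n = (fact (2 * n) / (4 ^ n * fact n) :: 'a::field_char_0)"
  by (simp add: fact_double power_mult)

lemma pochhammer_three_half_eq:
  "pochhammer (3 / 2) n = (fact (2 * n + 1) / (4 ^ n * fact n) :: 'a::field_char_0)"
  by (simp only: fact_double_Suc) simp

text \<open>Going up \<open>m\<close> steps by the recurrence of \<open>rGamma\<close> reaches
  \<open>rGamma (1/2)\<close>, which is the reciprocal of the square root of pi.\<close>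

lemma rGamma_half_minus_of_nat:
  "rGamma (1 / 2 - of_nat m) * of_real (sqrt pi) = ((-1) ^ m * fact (2 * m) / (4 ^ m * fact m) :: complex)"
proof -
  have "rGamma (1 / 2 - of_nat m :: complex) = pochhammer (- (1 / 2) - of_nat m + 1) m * rGamma (1 / 2)"
    using pochhammer_rGamma[of "1 / 2 - of_nat m :: complex" m] by (simp add: algebra_simps)
  also have "pochhammer (- (1 / 2) - of_nat m + 1) m = ((-1) ^ m * pochhammer (1 / 2) m :: complex)"
    using pochhammer_minus'[of "- (1 / 2) :: complex" m] by (simp only: minus_minus)
  finally show ?thesis
    by (simp add: rGamma_inverse_Gamma Gamma_one_half_complex pochhammer_half_eq)
qed

lemma kummer_M_neg_of_nat:
  "kummer_M (- of_nat m) b z = (\<Sum>j\<le>m. pochhammer (- of_nat m) j * z ^ j / (pochhammer b j * fact j))"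
  unfolding kummer_M_def
  by (rule suminf_finite) (auto simp: pochhammer_of_nat_eq_0_lemma not_le)

text \<open>The surviving even indices are written as \<open>k = 2 * (m - j)\<close>, so that the
  sum runs over the power of \<open>z\<close>, as in the Kummer series.\<close>

lemma hermite_coeff_even:
  "hermite_coeff c (2 * m) z = (\<Sum>j\<le>m. c ^ (m - j) / fact (m - j) * ((2 * z) ^ (2 * j) / fact (2 * j)))"
proof -
  have "hermite_coeff c (2 * m) z =
     (\<Sum>k\<in>(\<lambda>j. 2 * (m - j)) ` {..m}. c ^ (k div 2) / fact (k div 2) * ((2 * z) ^ (2 * m - k) / fact (2 * m - k)))"
    unfolding hermite_coeff_def
  proof (rule sum.mono_neutral_cong_right)
    show "\<forall>i\<in>{..2 * m} - (\<lambda>j. 2 * (m - j)) ` {..m}.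
       (if even i then c ^ (i div 2) / fact (i div 2) else 0) * ((2 * z) ^ (2 * m - i) / fact (2 * m - i)) = 0"
    proof
      fix i assume i: "i \<in> {..2 * m} - (\<lambda>j. 2 * (m - j)) ` {..m}"
      have "odd i"
      proof
        assume "even i"
        then have "i = 2 * (m - (m - i div 2))" using i by auto
        with i show False by auto
      qed
      then show "(if even i then c ^ (i div 2) / fact (i div 2) else 0) * ((2 * z) ^ (2 * m - i) / fact (2 * m - i)) = 0"
        by simp
    qed
  qed auto
  also have "\<dots> = (\<Sum>j\<le>m. c ^ (m - j) / fact (m - j) * ((2 * z) ^ (2 * j) / fact (2 * j)))"
  proof (subst sum.reindex)
    have "2 * m - 2 * (m - j) = 2 * j" if "j \<le> m" for j using that by simp
    then show "sum ((\<lambda>k. c ^ (k div 2) / fact (k div 2) * ((2 * z) ^ (2 * m - k) / fact (2 * m - k))) \<circ>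
         (\<lambda>j. 2 * (m - j))) {..m} =
      (\<Sum>j\<le>m. c ^ (m - j) / fact (m - j) * ((2 * z) ^ (2 * j) / fact (2 * j)))"
      by (intro sum.cong) auto
  qed (auto simp: inj_on_def)
  finally show ?thesis .
qed

lemma hermite_coeff_odd:
  "hermite_coeff c (2 * m + 1) z =
     (\<Sum>j\<le>m. c ^ (m - j) / fact (m - j) * ((2 * z) ^ (2 * j + 1) / fact (2 * j + 1)))"
proof -
  have "hermite_coeff c (2 * m + 1) z =
     (\<Sum>k\<in>(\<lambda>j. 2 * (m - j)) ` {..m}. c ^ (k div 2) / fact (k div 2) * ((2 * z) ^ (2 * m + 1 - k) / fact (2 * m + 1 - k)))"
    unfolding hermite_coeff_def
  proof (rule sum.mono_neutral_cong_right)
    show "\<forall>i\<in>{..2 * m + 1} - (\<lambda>j. 2 * (m - j)) ` {..m}.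
       (if even i then c ^ (i div 2) / fact (i div 2) else 0) * ((2 * z) ^ (2 * m + 1 - i) / fact (2 * m + 1 - i)) = 0"
    proof
      fix i assume i: "i \<in> {..2 * m + 1} - (\<lambda>j. 2 * (m - j)) ` {..m}"
      have "odd i"
      proof
        assume "even i"
        then have "i = 2 * (m - (m - i div 2))" using i by auto
        with i show False by auto
      qed
      then show "(if even i then c ^ (i div 2) / fact (i div 2) else 0) * ((2 * z) ^ (2 * m + 1 - i) / fact (2 * m + 1 - i)) = 0"
        by simp
    qed
  qed auto
  also have "\<dots> = (\<Sum>j\<le>m. c ^ (m - j) / fact (m - j) * ((2 * z) ^ (2 * j + 1) / fact (2 * j + 1)))"
  proof (subst sum.reindex)
    have "2 * m + 1 - 2 * (m - j) = 2 * j + 1" if "j \<le> m" for j using that by simp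
    then show "sum ((\<lambda>k. c ^ (k div 2) / fact (k div 2) * ((2 * z) ^ (2 * m + 1 - k) / fact (2 * m + 1 - k))) \<circ>
         (\<lambda>j. 2 * (m - j))) {..m} =
      (\<Sum>j\<le>m. c ^ (m - j) / fact (m - j) * ((2 * z) ^ (2 * j + 1) / fact (2 * j + 1)))"
      by (intro sum.cong) auto
  qed (auto simp: inj_on_def)
  finally show ?thesis .
qed

lemma two_powr_of_nat: "(2::complex) powr of_nat n = 2 ^ n"
  by (simp add: powr_nat')

text \<open>Matches one term of a terminating Kummer series with one term of
  \<open>hermite_coeff\<close>, for both parities at once: \<open>A\<close> stands for
  \<open>(2j)!\<close> or \<open>(2j+1)!\<close>, \<open>F\<close> for \<open>n!\<close>, and
  \<open>z\<close> for the square of the Hermite variable.\<close>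

lemma kummer_term_eq:
  fixes m j :: nat and F A z :: "'a::field_char_0"
  assumes "j \<le> m"
  shows "(-1) ^ m * F / fact m * (pochhammer (- of_nat m) j * z ^ j / (A / (4 ^ j * fact j) * fact j)) =
    F * ((-1) ^ (m - j) / fact (m - j) * ((4 * z) ^ j / A))"
proof -
  have "(-1) ^ m = ((-1) ^ (m - j) * (-1) ^ j :: 'a)"
    using assms by (simp add: power_add[symmetric])
  moreover have "pochhammer (- of_nat m) j = ((-1) ^ j * fact m / fact (m - j) :: 'a)"
    using pochhammer_neg_of_nat_mult_fact[OF assms, where 'a='a] by (simp add: field_simps)
  moreover have "(-1) ^ j * (-1) ^ j = (1::'a)" by (subst power_mult_distrib[symmetric]) simp
  moreover have "s * e * F / M * (e * M / D * Z / (A / (Q * J) * J)) = F * (s / D * (Q * Z / A))"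
    if "e * e = 1" "M \<noteq> 0" "D \<noteq> 0" "Q \<noteq> 0" "J \<noteq> 0" for s e M D Z Q J :: 'a
  proof -
    have "s * e * F / M * (e * M / D * Z / (A / (Q * J) * J)) = (e * e) * (F * (s / D * (Q * Z / A)))"
      using that(2-) by (cases "A = 0") (auto simp: field_simps)
    then show ?thesis using that(1) by simp
  qed
  ultimately show ?thesis
    by (simp add: power_mult_distrib del: mult_minus_left mult_minus_right)
qed

text \<open>For each parity of \<open>n\<close>, one of the two \<open>rGamma\<close> factors sits
  at a nonpositive integer and vanishes, while the Kummer series of the other summand
  terminates.\<close>

lemma hermite_H_of_nat:
  "hermite_H (of_nat n) z = fact n * hermite_coeff (-1) n z"
proof (cases "even n")
  case True
  then obtain m where n: "n = 2 * m" by (elim evenE)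
  have "hermite_H (of_nat n) z =
      2 ^ (2 * m) * (rGamma (1 / 2 - of_nat m) * of_real (sqrt pi)) * kummer_M (- of_nat m) (1 / 2) (z\<^sup>2)"
    using two_powr_of_nat[of "2 * m"]
    by (simp add: hermite_H_def n rGamma_eq_zero_iff diff_divide_distrib)
  also have "\<dots> = (\<Sum>j\<le>m. (-1) ^ m * fact (2 * m) / fact m *
       (pochhammer (- of_nat m) j * (z\<^sup>2) ^ j / (fact (2 * j) / (4 ^ j * fact j) * fact j)))"
    by (simp add: rGamma_half_minus_of_nat kummer_M_neg_of_nat sum_distrib_left pochhammer_half_eq power_mult)
  also have "\<dots> = (\<Sum>j\<le>m. fact (2 * m) * ((-1) ^ (m - j) / fact (m - j) * ((4 * z\<^sup>2) ^ j / fact (2 * j))))"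
    by (intro sum.cong refl kummer_term_eq) auto
  also have "\<dots> = fact n * hermite_coeff (-1) n z"
    by (simp add: n hermite_coeff_even sum_distrib_left power_mult power_mult_distrib)
  finally show ?thesis .
next
  case False
  then obtain m where n: "n = 2 * m + 1" by (elim oddE)
  \<comment> \<open>This is the half-integer value at \<open>m + 1\<close>, with a common factor
    \<open>2 * (m + 1)\<close> cancelled so that the odd factorial appears.\<close>
  have *: "rGamma (- (1 / 2) - of_nat m) * of_real (sqrt pi) =
      ((-1) ^ Suc m * fact (2 * m + 1) / (2 * 4 ^ m * fact m) :: complex)"
  proof -
    have "fact (2 * Suc m) = (2 * (of_nat m + 1) * fact (2 * m + 1) :: complex)"
      by (simp add: algebra_simps)
    moreover have "4 ^ Suc m * fact (Suc m) = (2 * (of_nat m + 1) * (2 * 4 ^ m * fact m) :: complex)"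
      by (simp add: algebra_simps)
    moreover have "2 * (of_nat m + 1) \<noteq> (0::complex)"
      using of_nat_neq_0[of m, where 'a=complex] unfolding mult_eq_0_iff by (simp add: add.commute)
    ultimately have "fact (2 * Suc m) / (4 ^ Suc m * fact (Suc m)) =
        (fact (2 * m + 1) / (2 * 4 ^ m * fact m) :: complex)"
      by (simp only: mult_divide_mult_cancel_left not_False_eq_True)
    then have "(-1) ^ Suc m * fact (2 * Suc m) / (4 ^ Suc m * fact (Suc m)) =
        ((-1) ^ Suc m * fact (2 * m + 1) / (2 * 4 ^ m * fact m) :: complex)"
      by (metis times_divide_eq_right)
    moreover have "1 / 2 - of_nat (Suc m) = (- (1 / 2) - of_nat m :: complex)" by simp
    ultimately show ?thesis
      using rGamma_half_minus_of_nat[of "Suc m"] by metis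
  qed
  have "hermite_H (of_nat n) z =
      - (2 ^ (2 * m + 2) * (rGamma (- (1 / 2) - of_nat m) * of_real (sqrt pi)) * z * kummer_M (- of_nat m) (3 / 2) (z\<^sup>2))"
    using two_powr_of_nat[of "2 * m + 2"]
    by (simp add: hermite_H_def n rGamma_eq_zero_iff diff_divide_distrib add_divide_distrib ac_simps)
  also have "\<dots> = 2 * z * (\<Sum>j\<le>m. (-1) ^ m * fact (2 * m + 1) / fact m *
       (pochhammer (- of_nat m) j * (z\<^sup>2) ^ j / (fact (2 * j + 1) / (4 ^ j * fact j) * fact j)))"
    unfolding * kummer_M_neg_of_nat pochhammer_three_half_eq sum_distrib_left[symmetric]
    by (simp add: power_mult)
  also have "\<dots> = 2 * z * (\<Sum>j\<le>m. fact (2 * m + 1) * ((-1) ^ (m - j) / fact (m - j) * ((4 * z\<^sup>2) ^ j / fact (2 * j + 1))))"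
    by (intro arg_cong2[of _ _ _ _ "(*)"] sum.cong refl kummer_term_eq) auto
  also have "\<dots> = fact n * hermite_coeff (-1) n z"
    unfolding n hermite_coeff_odd sum_distrib_left
    by (intro sum.cong refl) (simp add: power_mult power_mult_distrib)
  finally show ?thesis .
qed

subsection \<open>Gaussian integrals\<close>

lemma has_bochner_integral_exp_neg_square:
  "has_bochner_integral lborel (\<lambda>x::real. exp (- x\<^sup>2)) (sqrt pi)"
  using has_bochner_integral_even_function[OF gaussian_moment_0] by simp

lemma has_bochner_integral_gaussian:
  fixes a b :: real
  assumes "a > 0"
  shows "has_bochner_integral lborel (\<lambda>x. exp (- a * x\<^sup>2 + b * x)) (sqrt (pi / a) * exp (b\<^sup>2 / (4 * a)))"
proof -
  have "has_bochner_integral lborel (\<lambda>x. exp (- (- b / (2 * sqrt a) + sqrt a * x)\<^sup>2)) (sqrt pi /\<^sub>R \<bar>sqrt a\<bar>)"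
    using has_bochner_integral_exp_neg_square assms
    by (subst lborel_has_bochner_integral_real_affine_iff[symmetric]) auto
  then have "has_bochner_integral lborel
      (\<lambda>x. exp (b\<^sup>2 / (4 * a)) * exp (- (- b / (2 * sqrt a) + sqrt a * x)\<^sup>2))
      (exp (b\<^sup>2 / (4 * a)) * (sqrt pi /\<^sub>R \<bar>sqrt a\<bar>))"
    by (rule has_bochner_integral_mult_right)
  moreover have "exp (b\<^sup>2 / (4 * a)) * exp (- (- b / (2 * sqrt a) + sqrt a * x)\<^sup>2) = exp (- a * x\<^sup>2 + b * x)" for x
  proof -
    have "b\<^sup>2 / (4 * a) - (- b / (2 * sqrt a) + sqrt a * x)\<^sup>2 = - a * x\<^sup>2 + b * x"
      using assms by (simp add: power2_diff power_mult_distrib power_divide)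
    then show ?thesis by (simp add: exp_add[symmetric])
  qed
  moreover have "exp (b\<^sup>2 / (4 * a)) * (sqrt pi /\<^sub>R \<bar>sqrt a\<bar>) = sqrt (pi / a) * exp (b\<^sup>2 / (4 * a))"
    using assms by (simp add: real_sqrt_divide inverse_eq_divide)
  ultimately show ?thesis by (simp only:)
qed

text \<open>The characteristic function of the standard normal distribution, rescaled by
  \<open>c = sqrt (2 * a)\<close>.\<close>

lemma has_bochner_integral_gaussian_fourier:
  fixes a b :: real
  assumes "a > 0"
  shows "has_bochner_integral lborel (\<lambda>x. exp (of_real (- a * x\<^sup>2) + \<i> * of_real (b * x)))
           (complex_of_real (sqrt (pi / a) * exp (- b\<^sup>2 / (4 * a))))"
proof -
  define c where "c = sqrt (2 * a)"
  have c: "c > 0" "c\<^sup>2 = 2 * a" using assms by (auto simp: c_def)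
  have int: "integrable lborel (\<lambda>x. std_normal_density x *\<^sub>R iexp (b / c * x))"
    by (rule Bochner_Integration.integrable_bound[of _ "\<lambda>x. std_normal_density x"])
       (auto simp: norm_mult normal_density_nonneg)
  have "complex_of_real (exp (- (b / c)\<^sup>2 / 2)) = (\<integral>x. iexp (b / c * x) \<partial>std_normal_distribution)"
    using char_std_normal_distribution[THEN fun_cong, of "b / c"] by (simp add: char_def)
  also have "\<dots> = (\<integral>x. std_normal_density x *\<^sub>R iexp (b / c * x) \<partial>lborel)"
    by (subst integral_density) (auto simp: normal_density_nonneg)
  finally have "has_bochner_integral lborel (\<lambda>x. std_normal_density x *\<^sub>R iexp (b / c * x))
      (complex_of_real (exp (- (b / c)\<^sup>2 / 2)))"
    using int by (simp add: has_bochner_integral_iff)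
  then have "has_bochner_integral lborel (\<lambda>x. std_normal_density (0 + c * x) *\<^sub>R iexp (b / c * (0 + c * x)))
      (complex_of_real (exp (- (b / c)\<^sup>2 / 2)) /\<^sub>R \<bar>c\<bar>)"
    using c by (subst lborel_has_bochner_integral_real_affine_iff[symmetric]) auto
  then have "has_bochner_integral lborel
      (\<lambda>x. sqrt (2 * pi) *\<^sub>R (std_normal_density (0 + c * x) *\<^sub>R iexp (b / c * (0 + c * x))))
      (sqrt (2 * pi) *\<^sub>R (complex_of_real (exp (- (b / c)\<^sup>2 / 2)) /\<^sub>R \<bar>c\<bar>))"
    by (rule has_bochner_integral_scaleR_right)
  moreover have "sqrt (2 * pi) *\<^sub>R (std_normal_density (0 + c * x) *\<^sub>R iexp (b / c * (0 + c * x))) =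
      exp (of_real (- a * x\<^sup>2) + \<i> * of_real (b * x))" for x
    using c by (simp add: std_normal_density_def scaleR_conv_of_real power_mult_distrib mult_exp_exp exp_of_real[symmetric])
  moreover have "sqrt (2 * pi) *\<^sub>R (complex_of_real (exp (- (b / c)\<^sup>2 / 2)) /\<^sub>R \<bar>c\<bar>) =
      complex_of_real (sqrt (pi / a) * exp (- b\<^sup>2 / (4 * a)))"
  proof -
    have "sqrt (2 * pi) / c = sqrt (pi / a)"
      using assms by (simp add: c_def real_sqrt_divide[symmetric])
    moreover have "(b / c)\<^sup>2 / 2 = b\<^sup>2 / (4 * a)"
      using c by (simp add: power_divide)
    moreover have "sqrt (2 * pi) *\<^sub>R (complex_of_real E /\<^sub>R \<bar>c\<bar>) = of_real (sqrt (2 * pi) / c * E)" for E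
      using c by (simp add: scaleR_conv_of_real divide_inverse)
    ultimately show ?thesis by simp
  qed
  ultimately show ?thesis by simp
qed

section \<open>Gaussian moments over the positive half-line\<close>

lemma has_bochner_integral_half_gaussian_moment:
  "has_bochner_integral lborel (\<lambda>t::real. indicator {0..} t * (t ^ k * exp (- t\<^sup>2))) (Gamma ((k + 1) / 2) / 2)"
proof (cases "even k")
  case True
  then obtain m where m: "k = 2 * m" by (elim evenE)
  have "Gamma (1 / 2 + real m) = pochhammer (1 / 2) m * sqrt pi"
  proof -
    have "1 / 2 \<notin> (\<int>\<^sub>\<le>\<^sub>0 :: real set)" by (auto dest!: nonpos_Ints_nonpos)
    from pochhammer_Gamma[OF this, of m] show ?thesis by (simp add: Gamma_one_half_real)
  qed
  also have "\<dots> = sqrt pi * (fact (2 * m) / (2 ^ (2 * m) * fact m))"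
    by (simp add: pochhammer_half_eq power_mult)
  finally show ?thesis
    using gaussian_moment_even_pos[of m] by (simp add: m add_divide_distrib add.commute mult_ac)
next
  case False
  then obtain m where m: "k = 2 * m + 1" by (elim oddE)
  have "Gamma (1 + real m) = fact m" by (rule Gamma_fact)
  then show ?thesis
    using gaussian_moment_odd_pos[of m] by (simp add: m add_divide_distrib add.commute mult_ac)
qed

text \<open>For \<open>t\<close> nonnegative, \<open>t^n\<close> is at most
  \<open>n! * exp t\<close>, so the power only raises the linear coefficient of a Gaussian exponent
  by 1.\<close>

lemma integrable_power_mult_half_gaussian:
  fixes b :: real
  shows "integrable lborel (\<lambda>t::real. indicator {0..} t * (t ^ n * exp (- t\<^sup>2 + b * t)))"
proof (rule Bochner_Integration.integrable_bound)
  show "integrable lborel (\<lambda>t. fact n * exp (- 1 * t\<^sup>2 + (b + 1) * t))"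
    using has_bochner_integral_gaussian[of 1 "b + 1"] by (simp add: has_bochner_integral_iff)
  have "t ^ n * exp (- t\<^sup>2 + b * t) \<le> fact n * exp (- 1 * t\<^sup>2 + (b + 1) * t)" if "t \<ge> 0" for t
  proof -
    have "(\<lambda>k. t ^ k / fact k) sums exp t"
      using exp_converges[of t] by (simp add: scaleR_conv_of_real field_simps)
    then have "t ^ n / fact n \<le> exp t"
      using sum_le_suminf[of "\<lambda>k. t ^ k / fact k" "{n}"] that by (auto simp: sums_iff)
    then have "t ^ n \<le> fact n * exp t" by (simp add: field_simps)
    then have "t ^ n * exp (- t\<^sup>2 + b * t) \<le> fact n * exp t * exp (- t\<^sup>2 + b * t)"
      by (intro mult_right_mono) auto
    then show ?thesis by (simp add: mult.assoc exp_add[symmetric] algebra_simps)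
  qed
  then show "AE t in lborel. norm (indicator {0..} t * (t ^ n * exp (- t\<^sup>2 + b * t))) \<le>
      norm (fact n * exp (- 1 * t\<^sup>2 + (b + 1) * t))"
    by (intro AE_I2) (auto simp: indicator_def)
qed auto

text \<open>This is \<open>n!\<close> times the Hermite function of order \<open>-n-1\<close>, as
  \<open>hermite_H_neg_of_nat\<close> shows. For \<open>n = 0\<close> it is a multiple of
  \<open>exp (\<eta>^2)\<close> times the complementary error function at
  \<open>\<eta>\<close>.\<close>

definition half_gaussian_moment :: "nat \<Rightarrow> real \<Rightarrow> real" where
  "half_gaussian_moment n \<eta> = (\<integral>t. indicator {0..} t * (t ^ n * exp (- t\<^sup>2 - 2 * \<eta> * t)) \<partial>lborel)"

text \<open>Expand \<open>exp (- 2 * \<eta> * t)\<close> and integrate term by term; each term is a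
  half-line moment of \<open>exp (- t^2)\<close>.\<close>

lemma
  shows half_gaussian_moment_sums:
    "(\<lambda>k. (- 2 * \<eta>) ^ k / fact k * (Gamma ((n + k + 1) / 2) / 2)) sums half_gaussian_moment n \<eta>"
    and half_gaussian_moment_series_summable:
    "summable (\<lambda>k. norm ((- 2 * \<eta>) ^ k / fact k * (Gamma ((n + k + 1) / 2) / 2)))"
proof -
  let ?f = "\<lambda>\<eta> k t. indicator {0..} t * ((- 2 * \<eta>) ^ k / fact k * (t ^ (n + k) * exp (- t\<^sup>2))) :: real"
  have exp_sums: "(\<lambda>k. ?f \<eta> k t) sums (indicator {0..} t * (t ^ n * exp (- t\<^sup>2 - 2 * \<eta> * t)))" for t \<eta>
  proof -
    have "(\<lambda>k. (- 2 * \<eta> * t) ^ k / fact k) sums exp (- 2 * \<eta> * t)"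
      using exp_converges[of "- 2 * \<eta> * t"] by (simp add: scaleR_conv_of_real field_simps)
    note s = sums_mult[OF this, of "indicator {0..} t * (t ^ n * exp (- t\<^sup>2))"]
    have f: "indicator {0..} t * (t ^ n * exp (- t\<^sup>2)) * ((- 2 * \<eta> * t) ^ k / fact k) = ?f \<eta> k t" for k
      by (subst power_mult_distrib) (simp only: power_add divide_inverse ac_simps)
    have g: "indicator {0..} t * (t ^ n * exp (- t\<^sup>2)) * exp (- 2 * \<eta> * t) =
        indicator {0..} t * (t ^ n * exp (- t\<^sup>2 - 2 * \<eta> * t))"
      by (simp add: mult.assoc exp_add[symmetric])
    show ?thesis using s unfolding f g .
  qed
  \<comment> \<open>The norms of the terms form the same series with \<open>\<eta>\<close> replaced
    by minus its absolute value, so the majorant is again of the shape already known to be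
    integrable.\<close>
  have norm_sums: "(\<lambda>k. norm (?f \<eta> k t)) sums (indicator {0..} t * (t ^ n * exp (- t\<^sup>2 + 2 * \<bar>\<eta>\<bar> * t)))" for t
  proof -
    have "norm (?f \<eta> k t) = indicator {0..} t * ((- 2 * (-\<bar>\<eta>\<bar>)) ^ k / fact k * (t ^ (n + k) * exp (- t\<^sup>2)))" for k
      by (auto simp: abs_mult power_abs indicator_def)
    then show ?thesis using exp_sums[where \<eta>="-\<bar>\<eta>\<bar>" and t=t] by simp
  qed
  have m: "?f \<eta> k \<in> borel_measurable lborel" for k by measurable
  note dom = m integrable_power_mult_half_gaussian[of n "2 * \<bar>\<eta>\<bar>"]
    sums_summable[OF norm_sums] order_eq_refl[OF sums_unique[OF norm_sums, symmetric]]
  have I: "integral\<^sup>L lborel (?f \<eta> k) = (- 2 * \<eta>) ^ k / fact k * (Gamma ((n + k + 1) / 2) / 2)" for k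
    using has_bochner_integral_mult_right[OF has_bochner_integral_half_gaussian_moment[of "n + k"],
        of "(- 2 * \<eta>) ^ k / fact k"]
    by (simp add: has_bochner_integral_iff ac_simps)
  show "(\<lambda>k. (- 2 * \<eta>) ^ k / fact k * (Gamma ((n + k + 1) / 2) / 2)) sums half_gaussian_moment n \<eta>"
    using dominated_series_sums[OF dom] unfolding I half_gaussian_moment_def sums_unique[OF exp_sums, symmetric] .
  show "summable (\<lambda>k. norm ((- 2 * \<eta>) ^ k / fact k * (Gamma ((n + k + 1) / 2) / 2)))"
    using dominated_series_summable[OF dom] unfolding I .
qed

text \<open>Legendre's duplication formula at \<open>(n+1)/2\<close>, taken over the complex numbers
  and read off for reals. It converts the Gamma factors of the integral into the reciprocal ones of
  \<open>hermite_H\<close>.\<close>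

lemma Gamma_half_mult_Gamma:
  "Gamma ((real n + 1) / 2) * Gamma (real n / 2 + 1) = 2 powr (- real n) * sqrt pi * fact n"
proof -
  have "(real n + 1) / 2 \<notin> \<int>\<^sub>\<le>\<^sub>0" "(real n + 1) / 2 + 1 / 2 \<notin> \<int>\<^sub>\<le>\<^sub>0"
    by (auto dest!: nonpos_Ints_nonpos simp: field_simps)
  then have "complex_of_real ((real n + 1) / 2) \<notin> \<int>\<^sub>\<le>\<^sub>0"
    "complex_of_real ((real n + 1) / 2) + 1 / 2 \<notin> \<int>\<^sub>\<le>\<^sub>0"
    using of_real_in_nonpos_Ints_iff[of "(real n + 1) / 2", where 'a=complex]
      of_real_in_nonpos_Ints_iff[of "(real n + 1) / 2 + 1 / 2", where 'a=complex] by simp_all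
  note Gamma_legendre_duplication[OF this]
  also have "2 * complex_of_real ((real n + 1) / 2) = 1 + of_nat n" by simp
  also have "complex_of_real ((real n + 1) / 2) + 1 / 2 = of_real (real n / 2 + 1)"
    by (simp add: field_simps)
  also have "exp ((1 - (1 + of_nat n)) * complex_of_real (ln 2)) = of_real (2 powr (- real n))"
    by (simp add: powr_def exp_of_real[symmetric])
  finally have "complex_of_real (Gamma ((real n + 1) / 2) * Gamma (real n / 2 + 1)) =
      of_real (2 powr (- real n) * sqrt pi * fact n)"
    by (simp only: Gamma_complex_of_real Gamma_fact of_real_mult of_real_fact)
  then show ?thesis by (simp only: of_real_eq_iff)
qed

subsection \<open>Hermite functions of negative integer order and Mehler's formula\<close>

lemma kummer_M_of_real:
  assumes "(\<lambda>j. pochhammer a j * x ^ j / (pochhammer b j * fact j)) sums s"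
  shows "kummer_M (of_real a) (of_real b) (of_real x) = of_real s"
proof -
  have "(\<lambda>j. complex_of_real (pochhammer a j * x ^ j / (pochhammer b j * fact j))) sums of_real s"
    using assms by (simp only: sums_of_real_iff)
  then show ?thesis
    by (simp add: kummer_M_def sums_iff pochhammer_of_real)
qed

text \<open>Splitting the series in \<open>\<eta>\<close> by parity gives the two Kummer functions:
  raising \<open>k\<close> by 2 raises the Gamma argument by 1, which produces the Pochhammer
  symbol, and the even or odd factorial gives the lower parameter 1/2 or 3/2.\<close>

lemma half_gaussian_moment_eq_kummer:
  fixes n :: nat and \<eta> :: real
  shows "complex_of_real (half_gaussian_moment n \<eta>) =
    of_real (Gamma ((real n + 1) / 2) / 2) * kummer_M ((of_nat n + 1) / 2) (1 / 2) ((of_real \<eta>)\<^sup>2) -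
    of_real (\<eta> * Gamma (real n / 2 + 1)) * kummer_M (of_nat n / 2 + 1) (3 / 2) ((of_real \<eta>)\<^sup>2)"
proof -
  define c where "c k = (- 2 * \<eta>) ^ k / fact k * (Gamma ((n + k + 1) / 2) / 2)" for k :: nat
  let ?G1 = "Gamma ((real n + 1) / 2) / 2" and ?G2 = "\<eta> * Gamma (real n / 2 + 1)"
  have abs: "summable (\<lambda>k. norm (c k))"
    unfolding c_def by (rule half_gaussian_moment_series_summable)
  have sub: "summable (\<lambda>j. c (g j))" if "inj g" for g :: "nat \<Rightarrow> nat"
    using summable_reindex[OF abs that] by (intro summable_norm_cancel[of "\<lambda>j. c (g j)"]) (simp add: o_def)
  have se: "(\<lambda>j. c (2 * j)) sums (\<Sum>j. c (2 * j))"
    using sub[of "\<lambda>j. 2 * j"] by (auto simp: inj_on_def sums_iff)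
  have so: "(\<lambda>j. c (2 * j + 1)) sums (\<Sum>j. c (2 * j + 1))"
    using sub[of "\<lambda>j. 2 * j + 1"] by (auto simp: inj_on_def sums_iff)
  have "c = (\<lambda>k. if even k then c (2 * (k div 2)) else c (2 * ((k - 1) div 2) + 1))"
    by (auto simp: fun_eq_iff elim!: oddE)
  then have "c sums ((\<Sum>j. c (2 * j + 1)) + (\<Sum>j. c (2 * j)))"
    using sums_if[OF so se] by simp
  moreover have "c sums half_gaussian_moment n \<eta>"
    using half_gaussian_moment_sums unfolding c_def .
  ultimately have T: "half_gaussian_moment n \<eta> = (\<Sum>j. c (2 * j)) + (\<Sum>j. c (2 * j + 1))"
    using sums_unique2 by fastforce
  have Gamma_add: "Gamma (a + real j) = Gamma a * pochhammer a j" if "a > 0" for a j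
  proof -
    have "a \<notin> \<int>\<^sub>\<le>\<^sub>0" using that by (auto dest: nonpos_Ints_nonpos)
    from pochhammer_Gamma[OF this, of j] Gamma_real_pos[OF that] show ?thesis by simp
  qed
  have ce: "c (2 * j) = ?G1 * (pochhammer ((n + 1) / 2) j * (\<eta>\<^sup>2) ^ j / (pochhammer (1 / 2) j * fact j))" for j
  proof -
    have "Gamma ((n + 2 * j + 1) / 2) = Gamma ((real n + 1) / 2) * pochhammer ((real n + 1) / 2) j"
      using Gamma_add[of "(real n + 1) / 2" j] by (simp add: add_divide_distrib ac_simps)
    moreover have "(- 2 * \<eta>) ^ (2 * j) = 4 ^ j * (\<eta>\<^sup>2) ^ j"
      by (simp add: power_mult power_mult_distrib)
    ultimately show ?thesis
      unfolding c_def pochhammer_half_eq by (simp add: mult_ac add.commute)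
  qed
  have co: "c (2 * j + 1) = - ?G2 * (pochhammer (n / 2 + 1) j * (\<eta>\<^sup>2) ^ j / (pochhammer (3 / 2) j * fact j))" for j
  proof -
    have e: "real (n + (2 * j + 1) + 1) / 2 = real n / 2 + 1 + real j" by (simp add: field_simps)
    have "Gamma (real (n + (2 * j + 1) + 1) / 2) = Gamma (real n / 2 + 1) * pochhammer (real n / 2 + 1) j"
      unfolding e by (rule Gamma_add) simp
    then show ?thesis
      unfolding c_def pochhammer_three_half_eq
      by (simp add: power_mult power_mult_distrib)
  qed
  have "of_real (\<Sum>j. c (2 * j)) = of_real ?G1 * kummer_M (of_real ((n + 1) / 2)) (of_real (1 / 2)) (of_real (\<eta>\<^sup>2))"
  proof -
    let ?k = "\<lambda>j. pochhammer ((n + 1) / 2) j * (\<eta>\<^sup>2) ^ j / (pochhammer (1 / 2) j * fact j)"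
    have "Gamma ((real n + 1) / 2) > 0" by simp
    then have G: "Gamma ((real n + 1) / 2) \<noteq> 0" by (metis less_irrefl)
    have "(\<lambda>j. ?G1 * ?k j) sums (\<Sum>j. c (2 * j))"
      using se by (simp only: ce)
    from sums_divide[OF this, of ?G1] have "?k sums ((\<Sum>j. c (2 * j)) / ?G1)"
      using G by simp
    from kummer_M_of_real[OF this] show ?thesis using G by simp
  qed
  moreover have "of_real (\<Sum>j. c (2 * j + 1)) =
      - of_real ?G2 * kummer_M (of_real (n / 2 + 1)) (of_real (3 / 2)) (of_real (\<eta>\<^sup>2))"
  \<comment> \<open>The Kummer sum is isolated by dividing by a prefactor that contains
    \<open>\<eta>\<close>; for \<open>\<eta> = 0\<close> both sides vanish.\<close>
  proof (cases "\<eta> = 0")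
    case True
    then show ?thesis by (simp add: c_def)
  next
    case False
    let ?k = "\<lambda>j. pochhammer (n / 2 + 1) j * (\<eta>\<^sup>2) ^ j / (pochhammer (3 / 2) j * fact j)"
    have "Gamma (real n / 2 + 1) > 0" by simp
    then have "Gamma (real n / 2 + 1) \<noteq> 0" by (metis less_irrefl)
    then have G: "- ?G2 \<noteq> 0" using False by simp
    have "(\<lambda>j. - ?G2 * ?k j) sums (\<Sum>j. c (2 * j + 1))"
      using so by (simp only: co)
    from sums_divide[OF this, of "- ?G2"] have "?k sums ((\<Sum>j. c (2 * j + 1)) / (- ?G2))"
      using G by simp
    from kummer_M_of_real[OF this] show ?thesis using G by simp
  qed
  ultimately show ?thesis by (simp add: T add.commute)
qed

text \<open>The duplication formula turns both prefactors of \<open>hermite_H\<close> into those of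
  \<open>half_gaussian_moment_eq_kummer\<close> divided by \<open>n!\<close>. This is the integral
  representation of the Hermite functions of negative integer order.\<close>

lemma hermite_H_neg_of_nat:
  "hermite_H (- of_nat n - 1) (of_real \<eta>) = of_real (half_gaussian_moment n \<eta> / fact n)"
proof -
  let ?G1 = "Gamma ((real n + 1) / 2)" and ?G2 = "Gamma (real n / 2 + 1)"
  have G: "?G1 > 0" "?G2 > 0" by auto
  then have G': "?G1 \<noteq> 0" "?G2 \<noteq> 0" by (metis less_irrefl)+
  have p: "2 powr (- real n) * sqrt pi = ?G1 * ?G2 / fact n"
    using Gamma_half_mult_Gamma[of n] by (simp add: field_simps)
  have aux: "g * h / f / 2 * inverse h = g / 2 / f" "g * h / f * inverse g = h / f"
    if "g \<noteq> 0" "h \<noteq> 0" for f g h :: real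
    using that by (auto simp: field_simps)
  have powr_of_real: "(2::complex) powr (of_real x) = of_real (2 powr x)" for x :: real
    using powr_of_real[of 2 x] by simp
  have A: "(2::complex) powr (- of_nat n - 1) * of_real (sqrt pi) * rGamma ((1 - (- of_nat n - 1)) / 2) =
      of_real (?G1 / 2 / fact n)"
  proof -
    have "(2::complex) powr (- of_nat n - 1) = of_real (2 powr (- real n) / 2)"
      using powr_of_real[of "- real n - 1"] by (simp add: powr_diff)
    moreover have "(1 - (- of_nat n - 1)) / 2 = complex_of_real (real n / 2 + 1)" by (simp add: field_simps)
    then have "rGamma ((1 - (- of_nat n - 1)) / 2) = complex_of_real (inverse ?G2)"
      by (simp only: rGamma_complex_of_real) (simp add: rGamma_inverse_Gamma)
    ultimately have "(2::complex) powr (- of_nat n - 1) * of_real (sqrt pi) * rGamma ((1 - (- of_nat n - 1)) / 2) =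
       of_real ((2 powr (- real n) * sqrt pi) / 2 * inverse ?G2)"
      by simp
    also have "(2 powr (- real n) * sqrt pi) / 2 * inverse ?G2 = ?G1 / 2 / fact n"
      unfolding p by (rule aux[OF G'])
    finally show ?thesis .
  qed
  have B: "(2::complex) powr (- of_nat n - 1 + 1) * of_real (sqrt pi) * rGamma (- (- of_nat n - 1) / 2) =
      of_real (?G2 / fact n)"
  proof -
    have "(2::complex) powr (- of_nat n - 1 + 1) = of_real (2 powr (- real n))"
      using powr_of_real[of "- real n"] by simp
    moreover have "- (- of_nat n - 1) / 2 = complex_of_real ((real n + 1) / 2)" by (simp add: field_simps)
    then have "rGamma (- (- of_nat n - 1) / 2) = complex_of_real (inverse ?G1)"
      by (simp only: rGamma_complex_of_real) (simp add: rGamma_inverse_Gamma)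
    ultimately have "(2::complex) powr (- of_nat n - 1 + 1) * of_real (sqrt pi) * rGamma (- (- of_nat n - 1) / 2) =
       of_real ((2 powr (- real n) * sqrt pi) * inverse ?G1)"
      by simp
    also have "(2 powr (- real n) * sqrt pi) * inverse ?G1 = ?G2 / fact n"
      unfolding p by (rule aux[OF G'])
    finally show ?thesis .
  qed
  have args: "- (- of_nat n - 1) / 2 = ((of_nat n + 1) / 2 :: complex)"
    "(1 - (- of_nat n - 1)) / 2 = (of_nat n / 2 + 1 :: complex)"
    by (simp_all add: field_simps)
  have "of_real (half_gaussian_moment n \<eta> / fact n) =
     of_real (?G1 / 2 / fact n) * kummer_M ((of_nat n + 1) / 2) (1 / 2) ((of_real \<eta>)\<^sup>2) -
     of_real (?G2 / fact n) * of_real \<eta> * kummer_M (of_nat n / 2 + 1) (3 / 2) ((of_real \<eta>)\<^sup>2)"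
    unfolding of_real_divide[of "half_gaussian_moment n \<eta>"] half_gaussian_moment_eq_kummer
    by (simp add: field_simps)
  also have "\<dots> = hermite_H (- of_nat n - 1) (of_real \<eta>)"
    unfolding hermite_H_def A B unfolding args ..
  finally show ?thesis ..
qed

section \<open>Mehler's formula from Gaussian moments\<close>

lemma powser_of_real_sums_unique:
  fixes a b :: "nat \<Rightarrow> complex"
  assumes "0 < r"
    and a: "\<And>x::real. \<bar>x\<bar> < r \<Longrightarrow> (\<lambda>n. a n * of_real x ^ n) sums f x"
    and b: "\<And>x::real. \<bar>x\<bar> < r \<Longrightarrow> (\<lambda>n. b n * of_real x ^ n) sums f x"
  shows "a = b"
proof -
  have "(\<lambda>n. Re (a n)) = (\<lambda>n. Re (b n))"
    by (rule powser_sums_unique[OF \<open>0 < r\<close>, of _ "\<lambda>x. Re (f x)"])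
       (use sums_Re[OF a] sums_Re[OF b] in \<open>simp_all flip: of_real_power\<close>)
  moreover have "(\<lambda>n. Im (a n)) = (\<lambda>n. Im (b n))"
    by (rule powser_sums_unique[OF \<open>0 < r\<close>, of _ "\<lambda>x. Im (f x)"])
       (use sums_Im[OF a] sums_Im[OF b] in \<open>simp_all flip: of_real_power\<close>)
  ultimately show ?thesis by (simp add: complex_eq_iff fun_eq_iff)
qed

lemma integrable_gaussian_abs:
  fixes a b :: real
  assumes "a > 0"
  shows "integrable lborel (\<lambda>u. exp (- a * u\<^sup>2 + b * \<bar>u\<bar>))"
proof (rule Bochner_Integration.integrable_bound)
  show "integrable lborel (\<lambda>u. exp (- a * u\<^sup>2 + b * u) + exp (- a * u\<^sup>2 + (- b) * u))"
    using has_bochner_integral_gaussian[OF assms, of b] has_bochner_integral_gaussian[OF assms, of "- b"]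
    by (intro Bochner_Integration.integrable_add) (simp_all add: has_bochner_integral_iff)
  show "AE u in lborel. norm (exp (- a * u\<^sup>2 + b * \<bar>u\<bar>)) \<le>
      norm (exp (- a * u\<^sup>2 + b * u) + exp (- a * u\<^sup>2 + (- b) * u))"
  proof (rule AE_I2)
    fix u :: real
    show "norm (exp (- a * u\<^sup>2 + b * \<bar>u\<bar>)) \<le> norm (exp (- a * u\<^sup>2 + b * u) + exp (- a * u\<^sup>2 + (- b) * u))"
      by (cases "u \<ge> 0") (auto intro: add_increasing add_increasing2 simp del: exp_le_cancel_iff)
  qed
qed auto

text \<open>Along the vertical line through \<open>x\<close> the square of the norm is
  \<open>x^2 + u^2\<close>, so growth of order \<open>exp (C * norm z ^ 2)\<close> with
  \<open>C < 1\<close> is beaten by \<open>exp (- u^2)\<close>. This justifies integrating the power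
  series term by term.\<close>

lemma gaussian_series_sums:
  fixes a :: "nat \<Rightarrow> complex" and S :: "complex \<Rightarrow> complex" and x A B C :: real
  assumes sums: "\<And>z. (\<lambda>n. a n * z ^ n) sums S z"
    and sm: "\<And>z. summable (\<lambda>n. norm (a n * z ^ n))"
    and le: "\<And>z. (\<Sum>n. norm (a n * z ^ n)) \<le> exp (A + B * norm z + C * (norm z)\<^sup>2)"
    and B: "B \<ge> 0" and C: "C < 1"
  shows "(\<lambda>n. a n * (\<integral>u. (of_real x + \<i> * of_real u) ^ n * of_real (exp (- u\<^sup>2)) \<partial>lborel)) sums
      (\<integral>u. S (of_real x + \<i> * of_real u) * of_real (exp (- u\<^sup>2)) \<partial>lborel)"
proof -
  let ?z = "\<lambda>u. of_real x + \<i> * of_real u :: complex"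
  let ?f = "\<lambda>n u. a n * ?z u ^ n * of_real (exp (- u\<^sup>2))"
  let ?w = "\<lambda>u. exp (A + B * \<bar>x\<bar> + C * x\<^sup>2) * exp (- (1 - C) * u\<^sup>2 + B * \<bar>u\<bar>)"
  have norm_f: "norm (?f n u) = norm (a n * ?z u ^ n) * exp (- u\<^sup>2)" for n u
    by (simp add: norm_mult norm_of_real)
  have m: "?f n \<in> borel_measurable lborel" for n by measurable
  have w: "integrable lborel ?w"
    using integrable_gaussian_abs[of "1 - C" B] C by simp
  have s: "summable (\<lambda>n. norm (?f n u))" for u
    unfolding norm_f by (intro summable_mult2 sm)
  have l: "(\<Sum>n. norm (?f n u)) \<le> ?w u" for u
  proof -
    have "(\<Sum>n. norm (?f n u)) = (\<Sum>n. norm (a n * ?z u ^ n)) * exp (- u\<^sup>2)"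
      unfolding norm_f using sm by (rule suminf_mult2[symmetric])
    also have "\<dots> \<le> exp (A + B * norm (?z u) + C * (norm (?z u))\<^sup>2) * exp (- u\<^sup>2)"
      by (intro mult_right_mono le) auto
    also have "(norm (?z u))\<^sup>2 = x\<^sup>2 + u\<^sup>2" by (simp add: cmod_power2)
    also have "exp (A + B * norm (?z u) + C * (x\<^sup>2 + u\<^sup>2)) * exp (- u\<^sup>2) =
        exp (A + C * x\<^sup>2 - (1 - C) * u\<^sup>2 + B * norm (?z u))"
      by (simp add: exp_add[symmetric] algebra_simps)
    also have "\<dots> \<le> exp (A + C * x\<^sup>2 - (1 - C) * u\<^sup>2 + B * (\<bar>x\<bar> + \<bar>u\<bar>))"
      using norm_triangle_ineq[of "of_real x :: complex" "\<i> * of_real u"] B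
      by (auto intro!: mult_left_mono simp: norm_mult)
    also have "\<dots> = ?w u"
      by (simp add: exp_add[symmetric] algebra_simps)
    finally show ?thesis .
  qed
  have "(\<lambda>n. integral\<^sup>L lborel (?f n)) sums (\<integral>u. (\<Sum>n. ?f n u) \<partial>lborel)"
    by (rule dominated_series_sums[OF m w s l])
  moreover have "integral\<^sup>L lborel (?f n) = a n * (\<integral>u. ?z u ^ n * of_real (exp (- u\<^sup>2)) \<partial>lborel)" for n
    by (simp only: mult.assoc integral_mult_right_zero)
  moreover have "(\<Sum>n. ?f n u) = S (?z u) * of_real (exp (- u\<^sup>2))" for u
    by (rule sums_unique[symmetric]) (rule sums_mult2[OF sums])
  ultimately show ?thesis by simp
qed

text \<open>The Hermite polynomial is a Gaussian average of \<open>(x + \<i> u)^n\<close>. Both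
  sides have, up to the same scaling, the generating function \<open>exp (2 * x * s - s^2)\<close>;
  on the integral side it comes from a Gaussian Fourier integral at frequency
  \<open>2 * s\<close>.\<close>

lemma hermite_coeff_moment:
  "(\<integral>u. (of_real x + \<i> * of_real u) ^ n * of_real (exp (- u\<^sup>2)) \<partial>lborel) =
     complex_of_real (sqrt pi * fact n * hermite_coeff (-1) n x / 2 ^ n)"
proof -
  let ?z = "\<lambda>u. of_real x + \<i> * of_real u :: complex"
  define I where "I n = (\<integral>u. ?z u ^ n * of_real (exp (- u\<^sup>2)) \<partial>lborel)" for n
  have main: "(\<lambda>n. 2 ^ n / fact n * I n * of_real s ^ n) sums
      (complex_of_real (sqrt pi) * exp (2 * of_real x * of_real s + (-1) * (of_real s)\<^sup>2))" for s :: real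
  proof -
    let ?a = "\<lambda>n. (2 * of_real s) ^ n / fact n :: complex"
    have e: "(\<lambda>n. ?a n * z ^ n) sums exp (2 * of_real s * z)" for z
      using exp_converges[of "2 * of_real s * z"]
      by (simp add: scaleR_conv_of_real field_simps)
    have en: "(\<lambda>n. norm (?a n * z ^ n)) sums exp (2 * \<bar>s\<bar> * norm z)" for z
      using exp_converges[of "2 * \<bar>s\<bar> * norm z"]
      by (simp add: scaleR_conv_of_real field_simps norm_mult norm_divide norm_power)
    have "(\<lambda>n. ?a n * I n) sums (\<integral>u. exp (2 * of_real s * ?z u) * of_real (exp (- u\<^sup>2)) \<partial>lborel)"
      unfolding I_def
      by (rule gaussian_series_sums[where A=0 and B="2 * \<bar>s\<bar>" and C=0])
         (use e sums_summable[OF en] sums_unique[OF en] in auto)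
    also have "(\<lambda>u. exp (2 * of_real s * ?z u) * of_real (exp (- u\<^sup>2))) =
        (\<lambda>u. exp (2 * of_real s * of_real x) * exp (of_real (- 1 * u\<^sup>2) + \<i> * of_real (2 * s * u)))"
      by (simp add: exp_of_real[symmetric] mult_exp_exp algebra_simps)
    also have "integral\<^sup>L lborel \<dots> = exp (2 * of_real s * of_real x) * of_real (sqrt pi * exp (- (s\<^sup>2)))"
      using has_bochner_integral_gaussian_fourier[of 1 "2 * s"]
      by (simp only: integral_mult_right_zero has_bochner_integral_iff zero_less_one) (simp add: power_mult_distrib)
    finally show ?thesis
      by (simp add: exp_of_real[symmetric] mult_exp_exp exp_diff exp_minus field_simps)
  qed
  have "(\<lambda>n. 2 ^ n / fact n * I n) = (\<lambda>n. of_real (sqrt pi) * hermite_coeff (-1) n (of_real x))"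
  proof (rule powser_of_real_sums_unique[OF zero_less_one])
    show "(\<lambda>n. of_real (sqrt pi) * hermite_coeff (-1) n (of_real x) * of_real s ^ n) sums
        (complex_of_real (sqrt pi) * exp (2 * of_real x * of_real s + (-1) * (of_real s)\<^sup>2))" for s :: real
      unfolding mult.assoc by (intro sums_mult) (use hermite_coeff_sums[of "-1" "of_real x" "of_real s"] in \<open>simp add: mult.assoc\<close>)
  qed (rule main)
  then have "2 ^ n / fact n * I n = of_real (sqrt pi) * hermite_coeff (-1) n (of_real x)"
    by metis
  then show ?thesis
    using hermite_coeff_of_real[of "-1" n x, where 'a=complex] by (simp add: I_def field_simps)
qed

text \<open>Replacing the polynomial in \<open>x\<close> by its moment integral leaves under the
  integral the generating function in \<open>y\<close> at \<open>\<rho> * (x + \<i> u)\<close>. The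
  result is a Gaussian Fourier integral with quadratic coefficient
  \<open>1 - \<rho>^2\<close>.\<close>

lemma mehler:
  fixes \<rho> x y :: real
  assumes \<rho>: "\<bar>\<rho>\<bar> < 1"
  shows "(\<lambda>n. fact n * hermite_coeff (-1) n x * hermite_coeff (-1) n y * (\<rho> / 2) ^ n) sums
     (exp ((2 * x * y * \<rho> - (x\<^sup>2 + y\<^sup>2) * \<rho>\<^sup>2) / (1 - \<rho>\<^sup>2)) / sqrt (1 - \<rho>\<^sup>2))"
proof -
  let ?z = "\<lambda>u. of_real x + \<i> * of_real u :: complex"
  let ?h = "hermite_coeff (-1) :: nat \<Rightarrow> real \<Rightarrow> real"
  have \<rho>2: "\<rho>\<^sup>2 < 1" using \<rho> by (simp add: abs_square_less_1)
  \<comment> \<open>\<open>E\<close> is the part of the exponent free of \<open>u\<close>, and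
    \<open>L\<close> is the frequency multiplying \<open>\<i> u\<close>.\<close>
  define E where "E = 2 * y * \<rho> * x - \<rho>\<^sup>2 * x\<^sup>2"
  define L where "L = 2 * y * \<rho> - 2 * \<rho>\<^sup>2 * x"
  have eq: "complex_of_real (?h n y) * of_real \<rho> ^ n * z ^ n =
      hermite_coeff (-1) n (of_real y) * (of_real \<rho> * z) ^ n" for n z
    using hermite_coeff_of_real[of "-1" n y, where 'a=complex] by (simp add: power_mult_distrib)
  have "(\<lambda>n. of_real (?h n y) * of_real \<rho> ^ n *
       (\<integral>u. ?z u ^ n * of_real (exp (- u\<^sup>2)) \<partial>lborel)) sums
     (\<integral>u. exp (2 * of_real y * (of_real \<rho> * ?z u) + (-1) * (of_real \<rho> * ?z u)\<^sup>2) * of_real (exp (- u\<^sup>2)) \<partial>lborel)"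
  proof (rule gaussian_series_sums[where A=0 and B="2 * \<bar>y\<bar> * \<bar>\<rho>\<bar>" and C="\<rho>\<^sup>2"])
    fix z :: complex
    show "(\<lambda>n. of_real (?h n y) * of_real \<rho> ^ n * z ^ n) sums
      exp (2 * of_real y * (of_real \<rho> * z) + (-1) * (of_real \<rho> * z)\<^sup>2)"
      unfolding eq by (rule hermite_coeff_sums)
    show "summable (\<lambda>n. norm (of_real (?h n y) * of_real \<rho> ^ n * z ^ n))"
      unfolding eq by (rule hermite_coeff_norm_summable)
    show "(\<Sum>n. norm (of_real (?h n y) * of_real \<rho> ^ n * z ^ n)) \<le>
        exp (0 + 2 * \<bar>y\<bar> * \<bar>\<rho>\<bar> * norm z + \<rho>\<^sup>2 * (norm z)\<^sup>2)"
      unfolding eq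
      using hermite_coeff_norm_suminf_le[of "-1" "of_real y :: complex" "of_real \<rho> * z"]
      by (simp add: norm_mult power_mult_distrib mult.assoc)
  qed (use \<rho>2 in auto)
  also have "(\<lambda>u. exp (2 * of_real y * (of_real \<rho> * ?z u) + (-1) * (of_real \<rho> * ?z u)\<^sup>2) * of_real (exp (- u\<^sup>2))) =
      (\<lambda>u. of_real (exp E) * exp (of_real (- (1 - \<rho>\<^sup>2) * u\<^sup>2) + \<i> * of_real (L * u)))"
    by (simp add: exp_of_real[symmetric] mult_exp_exp E_def L_def power2_eq_square algebra_simps)
  also have "integral\<^sup>L lborel \<dots> =
      of_real (exp E) * of_real (sqrt (pi / (1 - \<rho>\<^sup>2)) * exp (- L\<^sup>2 / (4 * (1 - \<rho>\<^sup>2))))"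
    using has_bochner_integral_gaussian_fourier[of "1 - \<rho>\<^sup>2" L] \<rho>2
    by (simp only: integral_mult_right_zero has_bochner_integral_iff diff_gt_0_iff_gt)
  finally have "(\<lambda>n. complex_of_real (?h n y * \<rho> ^ n * (sqrt pi * fact n * ?h n x / 2 ^ n))) sums
      of_real (exp E * (sqrt (pi / (1 - \<rho>\<^sup>2)) * exp (- L\<^sup>2 / (4 * (1 - \<rho>\<^sup>2)))))"
    unfolding hermite_coeff_moment by simp
  then have "(\<lambda>n. ?h n y * \<rho> ^ n * (sqrt pi * fact n * ?h n x / 2 ^ n)) sums
      (exp E * (sqrt (pi / (1 - \<rho>\<^sup>2)) * exp (- L\<^sup>2 / (4 * (1 - \<rho>\<^sup>2)))))"
    by (simp only: sums_of_real_iff)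
  from sums_divide[OF this, of "sqrt pi"]
  have "(\<lambda>n. fact n * ?h n x * ?h n y * (\<rho> / 2) ^ n) sums
      (exp E * (sqrt (pi / (1 - \<rho>\<^sup>2)) * exp (- L\<^sup>2 / (4 * (1 - \<rho>\<^sup>2)))) / sqrt pi)"
    by (simp add: power_divide mult_ac)
  also have "exp E * (sqrt (pi / (1 - \<rho>\<^sup>2)) * exp (- L\<^sup>2 / (4 * (1 - \<rho>\<^sup>2)))) / sqrt pi =
      exp (E + - L\<^sup>2 / (4 * (1 - \<rho>\<^sup>2))) / sqrt (1 - \<rho>\<^sup>2)"
    by (simp only: exp_add real_sqrt_divide) simp
  also have "E + - L\<^sup>2 / (4 * (1 - \<rho>\<^sup>2)) = (2 * x * y * \<rho> - (x\<^sup>2 + y\<^sup>2) * \<rho>\<^sup>2) / (1 - \<rho>\<^sup>2)"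
    using \<rho>2 unfolding E_def L_def by (simp add: divide_simps) algebra
  finally show ?thesis .
qed

subsection \<open>The hyperbolic Gaussian kernel\<close>

lemma nn_integral_exp_neg:
  assumes "c > 0"
  shows "(\<integral>\<^sup>+q. ennreal (exp (- c * q)) * indicator {0..} q \<partial>lborel) = ennreal (1 / c)"
proof -
  have "(\<integral>\<^sup>+q. ennreal (exp (- c * q)) * indicator {0..} q \<partial>lborel) = ennreal (0 - (- exp (- c * 0) / c))"
  proof (rule nn_integral_FTC_atLeast)
    show "((\<lambda>q. - exp (- c * q) / c) has_real_derivative exp (- c * q)) (at q)" for q
      using assms by (auto intro!: derivative_eq_intros)
    have "((\<lambda>q. exp (- c * q)) \<longlongrightarrow> 0) at_top"
      using assms by (intro filterlim_compose[OF exp_at_bot] filterlim_tendsto_neg_mult_at_bot[OF tendsto_const])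
        (auto simp: filterlim_ident)
    from tendsto_divide[OF tendsto_minus[OF this] tendsto_const, of c] assms
    show "((\<lambda>q. - exp (- c * q) / c) \<longlongrightarrow> 0) at_top" by simp
  qed auto
  then show ?thesis by simp
qed

lemma image_square_add_linear:
  fixes \<eta> :: real
  assumes "\<eta> > 0"
  shows "(\<lambda>t. t\<^sup>2 + 2 * \<eta> * t) ` {0..} = {0..}"
proof safe
  fix x y :: real
  show "0 \<le> x \<Longrightarrow> 0 \<le> x\<^sup>2 + 2 * \<eta> * x" using assms by simp
  assume y: "0 \<le> y"
  \<comment> \<open>The preimage is the nonnegative root of the quadratic
    \<open>t^2 + 2 * \<eta> * t = y\<close>.\<close>
  have "y = (sqrt (y + \<eta>\<^sup>2) - \<eta>)\<^sup>2 + 2 * \<eta> * (sqrt (y + \<eta>\<^sup>2) - \<eta>)"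
    using y by (simp add: power2_diff algebra_simps power2_eq_square)
  moreover have "\<eta> \<le> sqrt (y + \<eta>\<^sup>2)" using y by (intro real_le_rsqrt) simp
  ultimately show "y \<in> (\<lambda>t. t\<^sup>2 + 2 * \<eta> * t) ` {0..}"
    by (intro image_eqI[of _ _ "sqrt (y + \<eta>\<^sup>2) - \<eta>"]) auto
qed

text \<open>Substitute \<open>q = t^2 + 2 * \<eta> * t\<close>: the derivative is
  \<open>2 * (t + \<eta>)\<close>, and \<open>t + \<eta>\<close> is the square root of
  \<open>q + \<eta>^2\<close>.\<close>

lemma half_gaussian_moment_0_alt:
  assumes \<eta>: "\<eta> > 0"
  shows "has_bochner_integral lborel (\<lambda>q. indicator {0..} q * (exp (- q) * sqrt (pi / (q + \<eta>\<^sup>2))))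
           (2 * sqrt pi * half_gaussian_moment 0 \<eta>)"
proof -
  let ?f = "\<lambda>q. exp (- q) * sqrt (pi / (q + \<eta>\<^sup>2))" and ?g = "\<lambda>t. t\<^sup>2 + 2 * \<eta> * t" and ?h = "\<lambda>t. 2 * t + 2 * \<eta>"
  have "has_bochner_integral lborel (\<lambda>t. 2 * sqrt pi * (indicator {0..} t * (t ^ 0 * exp (- t\<^sup>2 - 2 * \<eta> * t))))
     (2 * sqrt pi * half_gaussian_moment 0 \<eta>)"
    using integrable_power_mult_half_gaussian[of 0 "- 2 * \<eta>"]
    by (intro has_bochner_integral_mult_right) (simp add: has_bochner_integral_iff half_gaussian_moment_def)
  also have "(\<lambda>t. 2 * sqrt pi * (indicator {0..} t * (t ^ 0 * exp (- t\<^sup>2 - 2 * \<eta> * t)))) =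
      (\<lambda>t. indicator {0..} t * (\<bar>?h t\<bar> * ?f (?g t)))"
  proof
    fix t :: real
    show "2 * sqrt pi * (indicator {0..} t * (t ^ 0 * exp (- t\<^sup>2 - 2 * \<eta> * t))) =
       indicator {0..} t * (\<bar>?h t\<bar> * ?f (?g t))"
    proof (cases "t \<ge> 0")
      case True
      have "?g t + \<eta>\<^sup>2 = (t + \<eta>)\<^sup>2" by (simp add: power2_sum)
      then have "sqrt (pi / (?g t + \<eta>\<^sup>2)) = sqrt pi / (t + \<eta>)"
        using True \<eta> by (simp add: real_sqrt_divide)
      moreover have "t + \<eta> \<noteq> 0" using True \<eta> by simp
      ultimately have "?h t * ?f (?g t) = 2 * sqrt pi * exp (- t\<^sup>2 - 2 * \<eta> * t)"
        by (simp add: divide_simps) (simp add: algebra_simps)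
      then show ?thesis using True \<eta> by simp
    qed simp
  qed
  also have "has_bochner_integral lborel \<dots> (2 * sqrt pi * half_gaussian_moment 0 \<eta>) \<longleftrightarrow>
    has_bochner_integral lborel (\<lambda>q. indicator (?g ` {0..}) q * ?f q) (2 * sqrt pi * half_gaussian_moment 0 \<eta>)"
  proof (rule lborel_change_of_variables)
    show "inj_on ?g {0..}"
    proof (rule inj_onI)
      fix x y assume "x \<in> {0..}" "y \<in> {0..}" "?g x = ?g y"
      then have "(x - y) * (x + y + 2 * \<eta>) = 0" and "x + y + 2 * \<eta> > 0"
        using \<eta> by (auto simp: algebra_simps power2_eq_square)
      then show "x = y" by simp
    qed
  qed (auto simp: image_square_add_linear[OF \<eta>] intro!: derivative_eq_intros)
  finally show ?thesis by (simp add: image_square_add_linear[OF \<eta>])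
qed

text \<open>Write \<open>1 / (1 + w^2)\<close> as the integral of
  \<open>exp (- (1 + w^2) * q)\<close> over nonnegative \<open>q\<close> and integrate over
  \<open>w\<close> first, which is Gaussian. The remaining \<open>q\<close>-integral is
  \<open>half_gaussian_moment_0_alt\<close>. Nonnegative integrals make the exchange
  immediate.\<close>

lemma has_bochner_integral_gaussian_div_one_plus_square:
  assumes \<eta>: "\<eta> > 0"
  shows "has_bochner_integral lborel (\<lambda>w. exp (- (\<eta>\<^sup>2 * w\<^sup>2)) / (1 + w\<^sup>2)) (2 * sqrt pi * half_gaussian_moment 0 \<eta>)"
proof (rule has_bochner_integral_nn_integral)
  let ?k = "\<lambda>w q. ennreal (exp (- (\<eta>\<^sup>2 * w\<^sup>2)) * exp (- (1 + w\<^sup>2) * q)) * indicator {0..} q"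
  note alt = half_gaussian_moment_0_alt[OF \<eta>]
  have "(\<integral>\<^sup>+w. ennreal (exp (- (\<eta>\<^sup>2 * w\<^sup>2)) / (1 + w\<^sup>2)) \<partial>lborel) = (\<integral>\<^sup>+w. \<integral>\<^sup>+q. ?k w q \<partial>lborel \<partial>lborel)"
  proof (rule nn_integral_cong)
    fix w :: real
    have c: "1 + w\<^sup>2 > 0" by (simp add: add_pos_nonneg)
    have "(\<integral>\<^sup>+q. ?k w q \<partial>lborel) =
        (\<integral>\<^sup>+q. ennreal (exp (- (\<eta>\<^sup>2 * w\<^sup>2))) * (ennreal (exp (- (1 + w\<^sup>2) * q)) * indicator {0..} q) \<partial>lborel)"
      by (simp add: ennreal_mult mult.assoc)
    also have "\<dots> = ennreal (exp (- (\<eta>\<^sup>2 * w\<^sup>2))) * ennreal (1 / (1 + w\<^sup>2))"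
      unfolding nn_integral_exp_neg[OF c, symmetric] by (rule nn_integral_cmult) auto
    finally show "ennreal (exp (- (\<eta>\<^sup>2 * w\<^sup>2)) / (1 + w\<^sup>2)) = (\<integral>\<^sup>+q. ?k w q \<partial>lborel)"
      using c by (simp add: ennreal_mult'[symmetric])
  qed
  also have "\<dots> = (\<integral>\<^sup>+q. \<integral>\<^sup>+w. ?k w q \<partial>lborel \<partial>lborel)"
    by (rule lborel_pair.Fubini'[symmetric]) measurable
  also have "\<dots> = (\<integral>\<^sup>+q. ennreal (indicator {0..} q * (exp (- q) * sqrt (pi / (q + \<eta>\<^sup>2)))) \<partial>lborel)"
  proof (rule nn_integral_cong)
    fix q :: real
    show "(\<integral>\<^sup>+w. ?k w q \<partial>lborel) = ennreal (indicator {0..} q * (exp (- q) * sqrt (pi / (q + \<eta>\<^sup>2))))"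
    proof (cases "q \<ge> 0")
      case True
      then have pos: "q + \<eta>\<^sup>2 > 0" using \<eta> by (simp add: add_nonneg_pos)
      have g: "has_bochner_integral lborel (\<lambda>w. exp (- q) * exp (- (q + \<eta>\<^sup>2) * w\<^sup>2 + 0 * w))
          (exp (- q) * (sqrt (pi / (q + \<eta>\<^sup>2)) * exp (0\<^sup>2 / (4 * (q + \<eta>\<^sup>2)))))"
        by (intro has_bochner_integral_mult_right has_bochner_integral_gaussian pos)
      have "(\<integral>\<^sup>+w. ?k w q \<partial>lborel) = (\<integral>\<^sup>+w. ennreal (exp (- q) * exp (- (q + \<eta>\<^sup>2) * w\<^sup>2 + 0 * w)) \<partial>lborel)"
        using True by (intro nn_integral_cong) (simp add: exp_add[symmetric] algebra_simps)
      also have "\<dots> = ennreal (exp (- q) * (sqrt (pi / (q + \<eta>\<^sup>2)) * exp (0\<^sup>2 / (4 * (q + \<eta>\<^sup>2)))))"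
        using g by (subst nn_integral_eq_integral) (auto simp: has_bochner_integral_iff)
      finally show ?thesis using True by simp
    qed simp
  qed
  also have "\<dots> = ennreal (2 * sqrt pi * half_gaussian_moment 0 \<eta>)"
    using alt by (subst nn_integral_eq_integral) (auto simp: has_bochner_integral_iff indicator_def add_nonneg_pos)
  finally show "(\<integral>\<^sup>+w. ennreal (exp (- (\<eta>\<^sup>2 * w\<^sup>2)) / (1 + w\<^sup>2)) \<partial>lborel) =
      ennreal (2 * sqrt pi * half_gaussian_moment 0 \<eta>)" .
  show "0 \<le> 2 * sqrt pi * half_gaussian_moment 0 \<eta>"
    unfolding half_gaussian_moment_def by (auto intro!: mult_nonneg_nonneg integral_nonneg_AE)
qed auto

section \<open>The kernel under hyperbolic shifts, and its zeroth moment\<close>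

lemma borel_measurable_sinh [measurable]: "sinh \<in> borel_measurable (borel :: real measure)"
  by (intro borel_measurable_continuous_onI continuous_intros)

lemma borel_measurable_cosh [measurable]: "cosh \<in> borel_measurable (borel :: real measure)"
  by (intro borel_measurable_continuous_onI continuous_intros)

lemma range_sinh_real: "range (sinh :: real \<Rightarrow> real) = UNIV"
  by (rule surjI[of _ arsinh]) (rule sinh_arsinh_real)

lemma has_bochner_integral_sinh_substitution:
  fixes f :: "real \<Rightarrow> real"
  assumes [measurable]: "f \<in> borel_measurable borel"
  shows "has_bochner_integral lborel (\<lambda>\<theta>. cosh \<theta> * f (sinh \<theta>)) b \<longleftrightarrow> has_bochner_integral lborel f b"
proof -
  have "(sinh has_real_derivative cosh x) (at x)" for x :: real
    by (auto intro!: derivative_eq_intros)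
  then show ?thesis
    using lborel_change_of_variables[of UNIV sinh f cosh b] by (simp add: range_sinh_real inj_def)
qed

text \<open>The hypothesis places the point \<open>(\<eta>, y)\<close> in the right-hand wedge,
  where hyperbolic polar coordinates exist. A shift by \<open>\<phi>\<close> then reduces the kernel
  to \<open>exp (- (R * sinh \<theta>)^2)\<close>.\<close>

lemma hyperbolic_polar:
  fixes \<eta> y :: real
  assumes "\<eta> > \<bar>y\<bar>"
  obtains R \<phi> where "R > 0" "\<eta> = R * cosh \<phi>" "y = R * sinh \<phi>"
proof
  define R where "R = sqrt (\<eta>\<^sup>2 - y\<^sup>2)"
  have "y\<^sup>2 < \<eta>\<^sup>2" using assms power_strict_mono[of "\<bar>y\<bar>" \<eta> 2] by simp
  then have R2: "R\<^sup>2 = \<eta>\<^sup>2 - y\<^sup>2" and R: "R > 0" by (auto simp: R_def)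
  show "R > 0" by fact
  show y: "y = R * sinh (arsinh (y / R))" using R by simp
  have "(R * cosh (arsinh (y / R)))\<^sup>2 = R\<^sup>2 + (R * sinh (arsinh (y / R)))\<^sup>2"
    unfolding power_mult_distrib cosh_square_eq by (simp only: algebra_simps)
  also have "\<dots> = \<eta>\<^sup>2" using y R2 by simp
  finally show "\<eta> = R * cosh (arsinh (y / R))"
    using assms R by (simp add: power2_eq_iff_nonneg)
qed

lemma has_bochner_integral_lborel_shift:
  fixes f :: "real \<Rightarrow> real"
  shows "has_bochner_integral lborel (\<lambda>x. f (t + x)) b \<longleftrightarrow> has_bochner_integral lborel f b"
  using lborel_has_bochner_integral_real_affine_iff[of 1 f b t] by simp

text \<open>This is what remains of the \<open>\<eta>\<close>-part of the integrand once
  \<open>exp ((\<eta>0^2 - \<eta>^2) / 2)\<close> is split off, with \<open>y\<close> in the place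
  of \<open>\<eta>0\<close>. The squared form shows its invariance under a shift of
  \<open>\<theta>\<close> combined with the corresponding hyperbolic rotation of
  \<open>(\<eta>, y)\<close>.\<close>

definition parabolic_kernel :: "real \<Rightarrow> real \<Rightarrow> real \<Rightarrow> real" where
  "parabolic_kernel \<eta> y \<theta> = exp (- (\<eta> * sinh \<theta> - y * cosh \<theta>)\<^sup>2)"

lemma parabolic_kernel_measurable [measurable]: "parabolic_kernel \<eta> y \<in> borel_measurable borel"
  unfolding parabolic_kernel_def[abs_def] by measurable

lemma parabolic_kernel_shift:
  "parabolic_kernel (R * cosh \<phi>) (R * sinh \<phi>) (\<phi> + \<theta>) = exp (- (R\<^sup>2 * (sinh \<theta>)\<^sup>2))"
proof -
  have "cosh \<phi> * sinh (\<phi> + \<theta>) - sinh \<phi> * cosh (\<phi> + \<theta>) = sinh \<theta>"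
    using sinh_diff[of "\<phi> + \<theta>" \<phi>] by (simp add: mult.commute)
  moreover have "R * cosh \<phi> * sinh (\<phi> + \<theta>) - R * sinh \<phi> * cosh (\<phi> + \<theta>) =
      R * (cosh \<phi> * sinh (\<phi> + \<theta>) - sinh \<phi> * cosh (\<phi> + \<theta>))"
    by (simp add: algebra_simps)
  ultimately show ?thesis by (simp add: parabolic_kernel_def power_mult_distrib)
qed

text \<open>After the shift, multiplying by \<open>cosh \<theta>\<close>, which is at least 1, gives
  a majorant that \<open>s = sinh \<theta>\<close> turns into a Gaussian.\<close>

lemma parabolic_kernel_integrable:
  assumes "\<eta> > \<bar>y\<bar>"
  shows "integrable lborel (parabolic_kernel \<eta> y)"
proof -
  obtain R \<phi> where R: "R > 0" and eq: "\<eta> = R * cosh \<phi>" "y = R * sinh \<phi>"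
    using hyperbolic_polar[OF assms] .
  have "integrable lborel (\<lambda>\<theta>. exp (- (R\<^sup>2 * (sinh \<theta>)\<^sup>2)))"
  proof (rule Bochner_Integration.integrable_bound)
    have "has_bochner_integral lborel (\<lambda>s. exp (- (R\<^sup>2 * s\<^sup>2))) (sqrt (pi / R\<^sup>2))"
      using has_bochner_integral_gaussian[of "R\<^sup>2" 0] R by simp
    then have "has_bochner_integral lborel (\<lambda>\<theta>. cosh \<theta> * exp (- (R\<^sup>2 * (sinh \<theta>)\<^sup>2))) (sqrt (pi / R\<^sup>2))"
      by (subst has_bochner_integral_sinh_substitution) auto
    then show "integrable lborel (\<lambda>\<theta>. cosh \<theta> * exp (- (R\<^sup>2 * (sinh \<theta>)\<^sup>2)))"
      by (simp add: has_bochner_integral_iff)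
  qed (auto simp: abs_mult cosh_real_ge_1)
  then show ?thesis
    using has_bochner_integral_lborel_shift[of "parabolic_kernel \<eta> y" \<phi>]
    unfolding eq parabolic_kernel_shift by (auto simp: has_bochner_integral_iff)
qed

text \<open>After the shift the Gaussian factor is even, so
  \<open>1 / cosh (\<phi> + \<theta>)\<close> may be replaced by its even part, which is a function
  of \<open>sinh \<theta>\<close> times \<open>cosh \<theta>\<close>. The substitution
  \<open>s = sinh \<theta>\<close> then leaves an integral in which only
  \<open>\<eta> = R * cosh \<phi>\<close> survives.\<close>

lemma has_bochner_integral_parabolic_kernel_sech:
  assumes "\<eta> > \<bar>y\<bar>"
  shows "has_bochner_integral lborel (\<lambda>\<theta>. parabolic_kernel \<eta> y \<theta> / cosh \<theta>)
           (2 * sqrt pi * half_gaussian_moment 0 \<eta>)"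
proof -
  obtain R \<phi> where R: "R > 0" and eq: "\<eta> = R * cosh \<phi>" "y = R * sinh \<phi>"
    using hyperbolic_polar[OF assms] .
  let ?b = "2 * sqrt pi * half_gaussian_moment 0 \<eta>"
  let ?k = "\<lambda>\<theta>. exp (- (R\<^sup>2 * (sinh \<theta>)\<^sup>2)) / cosh (\<phi> + \<theta>)"
  let ?m = "\<lambda>\<theta>. cosh \<theta> * (cosh \<phi> * exp (- (R\<^sup>2 * (sinh \<theta>)\<^sup>2)) / ((cosh \<phi>)\<^sup>2 + (sinh \<theta>)\<^sup>2))"
  have "\<eta> > 0" using assms by linarith
  \<comment> \<open>The rescaling is \<open>w = s / cosh \<phi>\<close>, which turns
    \<open>\<eta>^2 * w^2\<close> into \<open>R^2 * s^2\<close>.\<close>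
  from has_bochner_integral_gaussian_div_one_plus_square[OF this]
  have "has_bochner_integral lborel (\<lambda>w. exp (- (\<eta>\<^sup>2 * (0 + 1 / cosh \<phi> * w)\<^sup>2)) / (1 + (0 + 1 / cosh \<phi> * w)\<^sup>2))
     (?b /\<^sub>R \<bar>1 / cosh \<phi>\<bar>)"
    by (subst lborel_has_bochner_integral_real_affine_iff[symmetric]) auto
  from has_bochner_integral_mult_right[OF this, of "1 / cosh \<phi>"]
  have "has_bochner_integral lborel (\<lambda>w. 1 / cosh \<phi> * (exp (- (\<eta>\<^sup>2 * (0 + 1 / cosh \<phi> * w)\<^sup>2)) / (1 + (0 + 1 / cosh \<phi> * w)\<^sup>2))) ?b"
    by simp
  also have "(\<lambda>w. 1 / cosh \<phi> * (exp (- (\<eta>\<^sup>2 * (0 + 1 / cosh \<phi> * w)\<^sup>2)) / (1 + (0 + 1 / cosh \<phi> * w)\<^sup>2))) =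
      (\<lambda>s. cosh \<phi> * exp (- (R\<^sup>2 * s\<^sup>2)) / ((cosh \<phi>)\<^sup>2 + s\<^sup>2))"
  proof
    fix s :: real
    have "\<eta>\<^sup>2 * (0 + 1 / cosh \<phi> * s)\<^sup>2 = R\<^sup>2 * s\<^sup>2"
      by (simp add: eq power_divide power_mult_distrib)
    moreover have "1 + (0 + 1 / cosh \<phi> * s)\<^sup>2 = ((cosh \<phi>)\<^sup>2 + s\<^sup>2) / (cosh \<phi>)\<^sup>2"
      by (simp add: power_divide add_divide_distrib)
    ultimately show "1 / cosh \<phi> * (exp (- (\<eta>\<^sup>2 * (0 + 1 / cosh \<phi> * s)\<^sup>2)) / (1 + (0 + 1 / cosh \<phi> * s)\<^sup>2)) =
      cosh \<phi> * exp (- (R\<^sup>2 * s\<^sup>2)) / ((cosh \<phi>)\<^sup>2 + s\<^sup>2)"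
      by (simp add: power2_eq_square)
  qed
  finally have m: "has_bochner_integral lborel ?m ?b"
    by (subst has_bochner_integral_sinh_substitution) auto
  have m_eq: "?m \<theta> = (?k \<theta> + ?k (- \<theta>)) / 2" for \<theta>
  proof -
    have c: "cosh (\<phi> + \<theta>) + cosh (\<phi> + - \<theta>) = 2 * (cosh \<phi> * cosh \<theta>)"
      by (simp add: cosh_add cosh_diff)
    have p: "cosh (\<phi> + \<theta>) * cosh (\<phi> + - \<theta>) = (cosh \<phi>)\<^sup>2 + (sinh \<theta>)\<^sup>2"
      using cosh_square_eq[of \<theta>] cosh_square_eq[of \<phi>]
      by (simp add: cosh_add cosh_diff) algebra
    have ab: "E / a + E / b = E * (a + b) / (a * b)" if "a \<noteq> 0" "b \<noteq> 0" for E a b :: real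
      using that by (simp add: field_simps)
    have "?k \<theta> + ?k (- \<theta>) = exp (- (R\<^sup>2 * (sinh \<theta>)\<^sup>2)) / cosh (\<phi> + \<theta>) + exp (- (R\<^sup>2 * (sinh \<theta>)\<^sup>2)) / cosh (\<phi> + - \<theta>)"
      by simp
    also have "\<dots> = exp (- (R\<^sup>2 * (sinh \<theta>)\<^sup>2)) * (2 * (cosh \<phi> * cosh \<theta>)) / ((cosh \<phi>)\<^sup>2 + (sinh \<theta>)\<^sup>2)"
      unfolding c[symmetric] p[symmetric] by (rule ab) auto
    finally have *: "(?k \<theta> + ?k (- \<theta>)) / 2 =
        exp (- (R\<^sup>2 * (sinh \<theta>)\<^sup>2)) * (2 * (cosh \<phi> * cosh \<theta>)) / ((cosh \<phi>)\<^sup>2 + (sinh \<theta>)\<^sup>2) / 2"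
      by (rule arg_cong)
    have "d * (c * E / D) = E * (2 * (c * d)) / D / 2" for c d D E :: real by simp
    then show ?thesis unfolding * .
  qed
  \<comment> \<open>Both halves of the symmetrised function are nonnegative, so each is bounded by
    twice the average, whose integrability is known.\<close>
  have ik: "integrable lborel ?k"
  proof (rule Bochner_Integration.integrable_bound)
    show "integrable lborel (\<lambda>\<theta>. 2 * ?m \<theta>)"
      using m by (simp only: has_bochner_integral_iff integrable_mult_right)
    show "AE \<theta> in lborel. norm (?k \<theta>) \<le> norm (2 * ?m \<theta>)"
    proof (rule AE_I2)
      fix \<theta> :: real
      have le: "\<bar>a\<bar> \<le> \<bar>2 * ((a + b) / 2)\<bar>" if "a \<ge> 0" "b \<ge> 0" for a b :: real using that by simp
      show "norm (?k \<theta>) \<le> norm (2 * ?m \<theta>)"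
        unfolding m_eq real_norm_def by (rule le) auto
    qed
  qed auto
  have ik': "integrable lborel (\<lambda>\<theta>. ?k (- \<theta>))" "(\<integral>\<theta>. ?k (- \<theta>) \<partial>lborel) = integral\<^sup>L lborel ?k"
    using lborel_integrable_real_affine[OF ik, of "-1" 0] lborel_integral_real_affine[of "-1" ?k 0] by simp_all
  have "?b = (\<integral>\<theta>. (?k \<theta> + ?k (- \<theta>)) / 2 \<partial>lborel)"
    using m unfolding m_eq by (simp add: has_bochner_integral_iff)
  also have "\<dots> = integral\<^sup>L lborel ?k"
    using ik ik' by simp
  finally have "has_bochner_integral lborel ?k ?b"
    using ik by (simp add: has_bochner_integral_iff)
  then show ?thesis
    using has_bochner_integral_lborel_shift[of "\<lambda>\<theta>. parabolic_kernel \<eta> y \<theta> / cosh \<theta>" \<phi> ?b]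
    by (simp add: eq parabolic_kernel_shift)
qed

text \<open>With \<open>tanh \<zeta> = z\<close> the denominator is
  \<open>cosh (\<theta> - \<zeta>) / d\<close>. A hyperbolic rotation of \<open>(\<eta>, y)\<close>
  by the same \<open>\<zeta>\<close> preserves the kernel, so the zeroth moment applies at the
  rotated point.\<close>

lemma parabolic_kernel_moment_generating:
  assumes \<eta>: "\<eta> > \<bar>y\<bar>" and z: "\<bar>z\<bar> < 1"
  defines "d \<equiv> 1 / sqrt (1 - z\<^sup>2)"
  shows "has_bochner_integral lborel (\<lambda>\<theta>. parabolic_kernel \<eta> y \<theta> / (cosh \<theta> - z * sinh \<theta>))
           (2 * sqrt pi * (d * half_gaussian_moment 0 (d * (\<eta> - z * y))))"
proof -
  let ?\<eta> = "d * (\<eta> - z * y)" and ?y = "d * (y - z * \<eta>)"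
  let ?b = "2 * sqrt pi * half_gaussian_moment 0 ?\<eta>"
  have z2: "z\<^sup>2 < 1" using z by (simp add: abs_square_less_1)
  then have d: "d > 0" and d2: "d\<^sup>2 * (1 - z\<^sup>2) = 1"
    by (auto simp: d_def power_divide)
  \<comment> \<open>This is \<open>artanh z\<close>, chosen through its \<open>sinh\<close> so that
    \<open>cosh \<zeta> = d\<close> and \<open>sinh \<zeta> = d * z\<close>.\<close>
  define \<zeta> where "\<zeta> = arsinh (z * d)"
  have sh: "sinh \<zeta> = d * z" by (simp add: \<zeta>_def)
  have "(cosh \<zeta>)\<^sup>2 = d\<^sup>2"
    unfolding cosh_square_eq sh using d2 by (simp add: power_mult_distrib algebra_simps)
  then have ch: "cosh \<zeta> = d" using d by (simp add: power2_eq_iff_nonneg)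
  \<comment> \<open>These are the sum and the difference of the rotated coordinates; their
    positivity keeps the point in the wedge.\<close>
  have "0 < d * ((\<eta> + y) * (1 - z))" "0 < d * ((\<eta> - y) * (1 + z))"
    using d \<eta> z by (auto intro!: mult_pos_pos)
  then have "?\<eta> > \<bar>?y\<bar>" by (simp add: abs_less_iff algebra_simps)
  from has_bochner_integral_parabolic_kernel_sech[OF this]
  have "has_bochner_integral lborel (\<lambda>\<theta>. parabolic_kernel ?\<eta> ?y (- \<zeta> + \<theta>) / cosh (- \<zeta> + \<theta>)) ?b"
    using has_bochner_integral_lborel_shift[of "\<lambda>\<theta>. parabolic_kernel ?\<eta> ?y \<theta> / cosh \<theta>" "- \<zeta>" ?b] by simp
  then have "has_bochner_integral lborel (\<lambda>\<theta>. d * (parabolic_kernel ?\<eta> ?y (- \<zeta> + \<theta>) / cosh (- \<zeta> + \<theta>))) (d * ?b)"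
    by (rule has_bochner_integral_mult_right)
  moreover have "d * (parabolic_kernel ?\<eta> ?y (- \<zeta> + \<theta>) / cosh (- \<zeta> + \<theta>)) =
      parabolic_kernel \<eta> y \<theta> / (cosh \<theta> - z * sinh \<theta>)" for \<theta>
  proof -
    have s: "sinh (- \<zeta> + \<theta>) = d * (sinh \<theta> - z * cosh \<theta>)"
      using sinh_diff[of \<theta> \<zeta>] by (simp add: sh ch algebra_simps)
    have c: "cosh (- \<zeta> + \<theta>) = d * (cosh \<theta> - z * sinh \<theta>)"
      using cosh_diff[of \<theta> \<zeta>] by (simp add: sh ch algebra_simps)
    have "?\<eta> * sinh (- \<zeta> + \<theta>) - ?y * cosh (- \<zeta> + \<theta>) =
        (d\<^sup>2 * (1 - z\<^sup>2)) * (\<eta> * sinh \<theta> - y * cosh \<theta>)"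
      unfolding s c by (simp add: power2_eq_square algebra_simps)
    then have "parabolic_kernel ?\<eta> ?y (- \<zeta> + \<theta>) = parabolic_kernel \<eta> y \<theta>"
      by (simp add: parabolic_kernel_def d2)
    then show ?thesis unfolding c using d by simp
  qed
  ultimately show ?thesis by (simp add: mult_ac)
qed

section \<open>Comparison of generating functions and the higher moments\<close>

lemma half_gaussian_scale:
  assumes d: "d > 0"
  shows "(\<integral>t. indicator {0..} t * exp (- ((t / d)\<^sup>2) - 2 * c * t) \<partial>lborel) = d * half_gaussian_moment 0 (d * c)"
proof -
  have "(\<integral>t. indicator {0..} t * exp (- ((t / d)\<^sup>2) - 2 * c * t) \<partial>lborel) =
     d * (\<integral>t. indicator {0..} (0 + d * t) * exp (- (((0 + d * t) / d)\<^sup>2) - 2 * c * (0 + d * t)) \<partial>lborel)"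
    using d by (subst lborel_integral_real_affine[of d _ 0]) auto
  also have "(\<lambda>t. indicator {0..} (0 + d * t) * exp (- (((0 + d * t) / d)\<^sup>2) - 2 * c * (0 + d * t))) =
      (\<lambda>t. indicator {0..} t * (t ^ 0 * exp (- t\<^sup>2 - 2 * (d * c) * t)))"
    using d by (auto simp: fun_eq_iff indicator_def zero_le_mult_iff)
  finally show ?thesis by (simp add: half_gaussian_moment_def)
qed

text \<open>Summing under the integral puts \<open>exp (2 * y * z * t + z^2 * t^2)\<close> beside
  the half-line Gaussian. Since \<open>z^2 < 1\<close> the quadratic coefficient stays negative, and
  rescaling by \<open>d\<close> returns a zeroth moment, the same one as in
  \<open>parabolic_kernel_moment_generating\<close>.\<close>

lemma hermite_coeff_half_gaussian_sums:
  assumes z: "\<bar>z\<bar> < 1"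
  defines "d \<equiv> 1 / sqrt (1 - z\<^sup>2)"
  shows "(\<lambda>n. hermite_coeff 1 n y * half_gaussian_moment n \<eta> * z ^ n) sums
     (d * half_gaussian_moment 0 (d * (\<eta> - z * y)))"
proof -
  have z2: "z\<^sup>2 < 1" using z by (simp add: abs_square_less_1)
  then have d: "d > 0" and d2: "1 / d\<^sup>2 = 1 - z\<^sup>2" by (auto simp: d_def power_divide)
  let ?g = "\<lambda>t. indicator {0..} t * exp (- t\<^sup>2 - 2 * \<eta> * t) :: real"
  let ?f = "\<lambda>n t. ?g t * (hermite_coeff 1 n y * (z * t) ^ n)"
  let ?w = "\<lambda>t. exp (- (1 - z\<^sup>2) * t\<^sup>2 + 2 * (\<bar>\<eta>\<bar> + \<bar>y\<bar> * \<bar>z\<bar>) * \<bar>t\<bar>)"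
  have norm_f: "norm (?f n t) = ?g t * norm (hermite_coeff 1 n y * (z * t) ^ n)" for n t
    by (simp add: abs_mult)
  have m: "?f n \<in> borel_measurable lborel" for n by measurable
  have w: "integrable lborel ?w" using z2 by (intro integrable_gaussian_abs) simp
  have s: "summable (\<lambda>n. norm (?f n t))" for t
    unfolding norm_f by (intro summable_mult hermite_coeff_norm_summable)
  have l: "(\<Sum>n. norm (?f n t)) \<le> ?w t" for t
  proof -
    have "(\<Sum>n. norm (?f n t)) = ?g t * (\<Sum>n. norm (hermite_coeff 1 n y * (z * t) ^ n))"
      unfolding norm_f by (intro suminf_mult hermite_coeff_norm_summable)
    also have "\<dots> \<le> ?g t * exp (2 * norm y * norm (z * t) + norm (1::real) * (norm (z * t))\<^sup>2)"
      by (intro mult_left_mono hermite_coeff_norm_suminf_le) auto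
    also have "\<dots> \<le> exp (- t\<^sup>2 - 2 * \<eta> * t) * exp (2 * norm y * norm (z * t) + norm (1::real) * (norm (z * t))\<^sup>2)"
      by (intro mult_right_mono) (auto simp: indicator_def)
    also have "\<dots> = exp (- (1 - z\<^sup>2) * t\<^sup>2 + (- 2 * \<eta> * t + 2 * (\<bar>y\<bar> * \<bar>z\<bar>) * \<bar>t\<bar>))"
      by (simp add: mult_exp_exp abs_mult power_mult_distrib algebra_simps)
    also have "\<dots> \<le> ?w t"
      using abs_ge_self[of "- \<eta> * t"] by (simp add: abs_mult algebra_simps)
    finally show ?thesis .
  qed
  have "(\<lambda>n. integral\<^sup>L lborel (?f n)) sums (\<integral>t. (\<Sum>n. ?f n t) \<partial>lborel)"
    by (rule dominated_series_sums[OF m w s l])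
  moreover have "integral\<^sup>L lborel (?f n) = hermite_coeff 1 n y * half_gaussian_moment n \<eta> * z ^ n" for n
  proof -
    have fe: "?f n = (\<lambda>t. (hermite_coeff 1 n y * z ^ n) * (indicator {0..} t * (t ^ n * exp (- t\<^sup>2 - 2 * \<eta> * t))))"
      by (simp add: fun_eq_iff power_mult_distrib)
    show ?thesis
      unfolding fe integral_mult_right_zero half_gaussian_moment_def by (simp only: mult_ac)
  qed
  moreover have "(\<Sum>n. ?f n t) = indicator {0..} t * exp (- ((t / d)\<^sup>2) - 2 * (\<eta> - z * y) * t)" for t
  proof -
    have "(\<lambda>n. ?f n t) sums (?g t * exp (2 * y * (z * t) + 1 * (z * t)\<^sup>2))"
      by (intro sums_mult hermite_coeff_sums)
    moreover have "exp (- t\<^sup>2 - 2 * \<eta> * t) * exp (2 * y * (z * t) + 1 * (z * t)\<^sup>2) =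
        exp (- ((t / d)\<^sup>2) - 2 * (\<eta> - z * y) * t)"
    proof -
      have "(t / d)\<^sup>2 = t\<^sup>2 * (1 - z\<^sup>2)" unfolding d2[symmetric] by (simp add: power_divide)
      then show ?thesis by (simp add: mult_exp_exp power_mult_distrib algebra_simps)
    qed
    ultimately show ?thesis by (simp add: sums_iff mult.assoc)
  qed
  ultimately show ?thesis using half_gaussian_scale[OF d, of "\<eta> - z * y"] by simp
qed

lemma abs_tanh_less_1: "\<bar>tanh x\<bar> < (1::real)"
  using tanh_real_lt_1[of x] tanh_real_gt_neg1[of x] by (simp add: abs_less_iff)

lemma borel_measurable_tanh [measurable]: "tanh \<in> borel_measurable (borel :: real measure)"
  by (intro borel_measurable_continuous_onI continuous_intros) auto

text \<open>A geometric series in \<open>z * tanh \<theta>\<close> shows that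
  \<open>1 / (cosh \<theta> - z * sinh \<theta>)\<close> generates these moments; equating
  coefficients with \<open>hermite_coeff_half_gaussian_sums\<close> gives each of them.\<close>

lemma parabolic_kernel_moment:
  assumes \<eta>: "\<eta> > \<bar>y\<bar>"
  shows "(\<integral>\<theta>. tanh \<theta> ^ n * (parabolic_kernel \<eta> y \<theta> / cosh \<theta>) \<partial>lborel) =
     2 * sqrt pi * (hermite_coeff 1 n y * half_gaussian_moment n \<eta>)"
proof -
  let ?k = "\<lambda>\<theta>. parabolic_kernel \<eta> y \<theta> / cosh \<theta>"
  let ?S = "\<lambda>z. 2 * sqrt pi * (1 / sqrt (1 - z\<^sup>2) * half_gaussian_moment 0 (1 / sqrt (1 - z\<^sup>2) * (\<eta> - z * y)))"
  have "(\<lambda>n. \<integral>\<theta>. tanh \<theta> ^ n * ?k \<theta> \<partial>lborel) = (\<lambda>n. 2 * sqrt pi * (hermite_coeff 1 n y * half_gaussian_moment n \<eta>))"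
  proof (rule powser_sums_unique[OF zero_less_one])
    fix z :: real assume "norm z < 1"
    then have z: "\<bar>z\<bar> < 1" by simp
    show "(\<lambda>n. 2 * sqrt pi * (hermite_coeff 1 n y * half_gaussian_moment n \<eta>) * z ^ n) sums ?S z"
      using sums_mult[OF hermite_coeff_half_gaussian_sums[OF z, of y \<eta>], of "2 * sqrt pi"] by (simp add: mult.assoc)
    let ?f = "\<lambda>n \<theta>. (z * tanh \<theta>) ^ n * ?k \<theta>"
    have zt: "\<bar>z * tanh \<theta>\<bar> \<le> \<bar>z\<bar>" for \<theta>
      unfolding abs_mult using abs_tanh_less_1[of \<theta>] by (intro mult_left_le) auto
    then have zt1: "norm (z * tanh \<theta>) < 1" for \<theta>
      using z by (metis le_less_trans real_norm_def)
    have k: "?k \<theta> \<ge> 0" for \<theta> by (simp add: parabolic_kernel_def)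
    have f: "(\<lambda>n. ?f n \<theta>) sums (1 / (1 - z * tanh \<theta>) * ?k \<theta>)" for \<theta>
      by (intro sums_mult2 geometric_sums zt1)
    have "(\<lambda>n. \<bar>z * tanh \<theta>\<bar> ^ n * ?k \<theta>) sums (1 / (1 - \<bar>z * tanh \<theta>\<bar>) * ?k \<theta>)" for \<theta>
      using zt1[of \<theta>] by (intro sums_mult2 geometric_sums) simp
    moreover have "norm (?f n \<theta>) = \<bar>z * tanh \<theta>\<bar> ^ n * ?k \<theta>" for n \<theta>
      by (simp only: real_norm_def abs_mult[of "(z * tanh \<theta>) ^ n"] power_abs abs_of_nonneg[OF k])
    ultimately have nf: "(\<lambda>n. norm (?f n \<theta>)) sums (1 / (1 - \<bar>z * tanh \<theta>\<bar>) * ?k \<theta>)" for \<theta>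
      by simp
    have m: "?f n \<in> borel_measurable lborel" for n by measurable
    \<comment> \<open>As \<open>tanh\<close> is bounded by 1 in absolute value, the geometric sums
      have a bound uniform in \<open>\<theta>\<close>.\<close>
    have w: "integrable lborel (\<lambda>\<theta>. 1 / (1 - \<bar>z\<bar>) * ?k \<theta>)"
      using has_bochner_integral_parabolic_kernel_sech[OF \<eta>]
      by (intro integrable_mult_right) (simp add: has_bochner_integral_iff)
    have l: "(\<Sum>n. norm (?f n \<theta>)) \<le> 1 / (1 - \<bar>z\<bar>) * ?k \<theta>" for \<theta>
      unfolding sums_unique[OF nf, symmetric]
      using zt[of \<theta>] z k[of \<theta>] by (intro mult_right_mono divide_left_mono) auto
    have "(\<lambda>n. integral\<^sup>L lborel (?f n)) sums (\<integral>\<theta>. (\<Sum>n. ?f n \<theta>) \<partial>lborel)"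
      by (rule dominated_series_sums[OF m w sums_summable[OF nf] l])
    moreover have "integral\<^sup>L lborel (?f n) = (\<integral>\<theta>. tanh \<theta> ^ n * ?k \<theta> \<partial>lborel) * z ^ n" for n
    proof -
      have fe: "?f n = (\<lambda>\<theta>. z ^ n * (tanh \<theta> ^ n * ?k \<theta>))"
        by (simp add: fun_eq_iff power_mult_distrib)
      show ?thesis unfolding fe integral_mult_right_zero by (rule mult.commute)
    qed
    moreover have "(\<integral>\<theta>. (\<Sum>n. ?f n \<theta>) \<partial>lborel) = ?S z"
    proof -
      have "(\<Sum>n. ?f n \<theta>) = parabolic_kernel \<eta> y \<theta> / (cosh \<theta> - z * sinh \<theta>)" for \<theta>
        unfolding sums_unique[OF f, symmetric] by (simp add: tanh_def field_simps)
      then show ?thesis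
        using parabolic_kernel_moment_generating[OF \<eta> z] by (simp add: has_bochner_integral_iff)
    qed
    ultimately show "(\<lambda>n. (\<integral>\<theta>. tanh \<theta> ^ n * ?k \<theta> \<partial>lborel) * z ^ n) sums ?S z" by simp
  qed
  then show ?thesis by meson
qed

section \<open>Integral representation of the Bessel function and the final summation\<close>

lemma bessel_K0_eq_integral:
  assumes A: "A > 0" and B: "B > 0"
    and int: "integrable lborel (\<lambda>\<theta>. exp (- (A * exp (- 2 * \<theta>) + B * exp (2 * \<theta>)) / 4))"
  shows "bessel_K0 (sqrt (A * B) / 2) = (\<integral>\<theta>. exp (- (A * exp (- 2 * \<theta>) + B * exp (2 * \<theta>)) / 4) \<partial>lborel)"
proof -
  let ?G = "\<lambda>\<theta>. exp (- (A * exp (- 2 * \<theta>) + B * exp (2 * \<theta>)) / 4)"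
  let ?r = "sqrt (A * B) / 2"
  \<comment> \<open>The shift balances the exponentials: with \<open>exp (4 * t) = A / B\<close>
    both coefficients become \<open>sqrt (A * B)\<close>. Writing
    \<open>\<theta> = t + x / 2\<close> then gives the exponent \<open>- r * cosh x\<close>.\<close>
  define t where "t = ln (A / B) / 4"
  have e: "exp (2 * t) = sqrt (A / B)" "exp (- 2 * t) = sqrt (B / A)"
  proof -
    have "exp (2 * t) = exp (ln (sqrt (A / B)))" using A B by (simp add: t_def ln_sqrt)
    then show *: "exp (2 * t) = sqrt (A / B)" using A B by simp
    show "exp (- 2 * t) = sqrt (B / A)" using * A B by (simp add: exp_minus real_sqrt_divide)
  qed
  have "A * sqrt (B / A) = sqrt (A * B)" "B * sqrt (A / B) = sqrt (A * B)"
    using A B by (simp_all add: real_sqrt_divide real_sqrt_mult real_div_sqrt field_simps)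
  then have eq: "?G (t + 1 / 2 * x) = exp (- ?r * cosh x)" for x
  proof -
    have "A * exp (- 2 * (t + 1 / 2 * x)) = (A * sqrt (B / A)) * exp (- x)"
      unfolding e[symmetric] by (simp add: mult_exp_exp algebra_simps)
    moreover have "B * exp (2 * (t + 1 / 2 * x)) = (B * sqrt (A / B)) * exp x"
      unfolding e[symmetric] by (simp add: mult_exp_exp algebra_simps)
    ultimately have "A * exp (- 2 * (t + 1 / 2 * x)) + B * exp (2 * (t + 1 / 2 * x)) = 4 * (?r * cosh x)"
      using \<open>A * sqrt (B / A) = sqrt (A * B)\<close> \<open>B * sqrt (A / B) = sqrt (A * B)\<close>
      by (simp add: cosh_def algebra_simps)
    then show ?thesis by simp
  qed
  have i: "integrable lborel (\<lambda>x. exp (- ?r * cosh x))"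
    using lborel_integrable_real_affine[OF int, of "1 / 2" t] unfolding eq by simp
  \<comment> \<open>The factor 1/2 from \<open>\<theta> = t + x / 2\<close> cancels the 2 from
    folding the even integrand onto the half-line.\<close>
  have "(\<integral>\<theta>. ?G \<theta> \<partial>lborel) = (\<integral>x. exp (- ?r * cosh x) \<partial>lborel) / 2"
    by (subst lborel_integral_real_affine[of "1 / 2" _ t]) (simp_all only: eq, simp_all)
  also have "(\<integral>x. exp (- ?r * cosh x) \<partial>lborel) = 2 * bessel_K0 ?r"
  proof -
    have "integrable lborel (\<lambda>x. indicator {0..} x *\<^sub>R exp (- ?r * cosh x))"
      by (intro integrable_mult_indicator i) auto
    then have "has_bochner_integral lborel (\<lambda>x. indicator {0..} x *\<^sub>R exp (- ?r * cosh x)) (bessel_K0 ?r)"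
      by (simp add: has_bochner_integral_iff bessel_K0_def set_lebesgue_integral_def)
    from has_bochner_integral_even_function[OF this]
    show ?thesis by (simp add: has_bochner_integral_iff)
  qed
  finally show ?thesis by simp
qed

lemma mehler_tanh:
  fixes \<theta> x y :: real
  shows "(\<lambda>n. fact n * hermite_coeff (-1) n x * hermite_coeff (-1) n y * (tanh \<theta> / 2) ^ n) sums
     (cosh \<theta> * exp (2 * x * y * (sinh \<theta> * cosh \<theta>) - (x\<^sup>2 + y\<^sup>2) * (sinh \<theta>)\<^sup>2))"
proof -
  have c: "cosh \<theta> > 0" by simp
  have t: "1 - (tanh \<theta>)\<^sup>2 = 1 / (cosh \<theta>)\<^sup>2"
  proof -
    have "1 - (tanh \<theta>)\<^sup>2 = ((cosh \<theta>)\<^sup>2 - (sinh \<theta>)\<^sup>2) / (cosh \<theta>)\<^sup>2"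
      using c by (simp add: tanh_def power_divide diff_divide_distrib)
    then show ?thesis by (simp only: hyperbolic_pythagoras)
  qed
  have "sqrt (1 - (tanh \<theta>)\<^sup>2) = 1 / cosh \<theta>"
    unfolding t using c by (simp add: real_sqrt_divide)
  moreover have "(2 * x * y * tanh \<theta> - (x\<^sup>2 + y\<^sup>2) * (tanh \<theta>)\<^sup>2) / (1 - (tanh \<theta>)\<^sup>2) =
     2 * x * y * (sinh \<theta> * cosh \<theta>) - (x\<^sup>2 + y\<^sup>2) * (sinh \<theta>)\<^sup>2"
  proof -
    have "tanh \<theta> * (cosh \<theta>)\<^sup>2 = sinh \<theta> * cosh \<theta>" "(tanh \<theta>)\<^sup>2 * (cosh \<theta>)\<^sup>2 = (sinh \<theta>)\<^sup>2"
      using c by (simp_all add: tanh_def power2_eq_square)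
    then show ?thesis unfolding t by (simp add: left_diff_distrib mult.assoc)
  qed
  ultimately show ?thesis
    using mehler[OF abs_tanh_less_1, of x y \<theta>] by (simp add: mult.commute)
qed

text \<open>The arithmetic-geometric mean inequality reduces the bound to the diagonal case at the
  absolute value of \<open>\<theta>\<close>, where the terms are nonnegative and Mehler's exponent
  is \<open>x^2 * (1 - exp (- 2 * \<bar>\<theta>\<bar>))\<close>, at most \<open>x^2\<close>. The
  only growth in \<open>\<theta>\<close> is thus \<open>cosh \<theta>\<close>, which the factor
  \<open>1 / cosh \<theta>\<close> of the integrand cancels.\<close>

lemma
  fixes \<theta> x y :: real
  defines "f \<equiv> \<lambda>n. fact n * hermite_coeff (-1) n x * hermite_coeff (-1) n y * (tanh \<theta> / 2) ^ n"
  shows mehler_tanh_norm_summable: "summable (\<lambda>n. norm (f n))"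
    and mehler_tanh_norm_suminf_le: "(\<Sum>n. norm (f n)) \<le> cosh \<theta> * ((exp (x\<^sup>2) + exp (y\<^sup>2)) / 2)"
proof -
  let ?h = "hermite_coeff (-1) :: nat \<Rightarrow> real \<Rightarrow> real"
  let ?g = "\<lambda>x n. fact n * ?h n x * ?h n x * (tanh \<bar>\<theta>\<bar> / 2) ^ n"
  have diag: "\<exists>s. ?g x sums s \<and> s \<le> cosh \<theta> * exp (x\<^sup>2)" for x
  proof (intro exI conjI)
    show "?g x sums (cosh \<bar>\<theta>\<bar> * exp (2 * x * x * (sinh \<bar>\<theta>\<bar> * cosh \<bar>\<theta>\<bar>) - (x\<^sup>2 + x\<^sup>2) * (sinh \<bar>\<theta>\<bar>)\<^sup>2))"
      by (rule mehler_tanh)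
    have e: "sinh \<bar>\<theta>\<bar> * exp (- \<bar>\<theta>\<bar>) = (1 - exp (- 2 * \<bar>\<theta>\<bar>)) / 2"
      by (simp add: sinh_def mult_exp_exp left_diff_distrib diff_divide_distrib)
    have "2 * (sinh \<bar>\<theta>\<bar> * exp (- \<bar>\<theta>\<bar>)) \<le> 1"
      unfolding e by simp
    then have "x\<^sup>2 * (2 * (sinh \<bar>\<theta>\<bar> * exp (- \<bar>\<theta>\<bar>))) \<le> x\<^sup>2 * 1"
      by (intro mult_left_mono) auto
    moreover have "2 * x * x * (sinh \<bar>\<theta>\<bar> * cosh \<bar>\<theta>\<bar>) - (x\<^sup>2 + x\<^sup>2) * (sinh \<bar>\<theta>\<bar>)\<^sup>2 =
        x\<^sup>2 * (2 * (sinh \<bar>\<theta>\<bar> * exp (- \<bar>\<theta>\<bar>)))"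
      unfolding cosh_minus_sinh[symmetric] by (simp add: power2_eq_square algebra_simps)
    ultimately show "cosh \<bar>\<theta>\<bar> * exp (2 * x * x * (sinh \<bar>\<theta>\<bar> * cosh \<bar>\<theta>\<bar>) - (x\<^sup>2 + x\<^sup>2) * (sinh \<bar>\<theta>\<bar>)\<^sup>2) \<le>
        cosh \<theta> * exp (x\<^sup>2)"
      by simp
  qed
  obtain sx where sx: "?g x sums sx" "sx \<le> cosh \<theta> * exp (x\<^sup>2)" using diag[of x] by blast
  obtain sy where sy: "?g y sums sy" "sy \<le> cosh \<theta> * exp (y\<^sup>2)" using diag[of y] by blast
  have am_gm: "norm (f n) \<le> (?g x n + ?g y n) / 2" for n
  proof -
    have "0 \<le> (\<bar>?h n x\<bar> - \<bar>?h n y\<bar>)\<^sup>2" by simp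
    then have "\<bar>?h n x * ?h n y\<bar> \<le> (?h n x * ?h n x + ?h n y * ?h n y) / 2"
      by (simp add: power2_eq_square abs_mult algebra_simps)
    then have "fact n * \<bar>tanh \<theta> / 2\<bar> ^ n * \<bar>?h n x * ?h n y\<bar> \<le>
       fact n * \<bar>tanh \<theta> / 2\<bar> ^ n * ((?h n x * ?h n x + ?h n y * ?h n y) / 2)"
      by (intro mult_left_mono) auto
    then show ?thesis
      by (simp add: f_def abs_mult power_abs algebra_simps)
  qed
  have s: "(\<lambda>n. (?g x n + ?g y n) / 2) sums ((sx + sy) / 2)"
    by (intro sums_divide sums_add sx sy)
  show sm: "summable (\<lambda>n. norm (f n))"
    by (rule summable_comparison_test_ev[OF _ sums_summable[OF s]]) (use am_gm in auto)
  have "(\<Sum>n. norm (f n)) \<le> (sx + sy) / 2"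
    using suminf_le[OF am_gm sm sums_summable[OF s]] s by (simp add: sums_iff)
  also have "\<dots> \<le> cosh \<theta> * ((exp (x\<^sup>2) + exp (y\<^sup>2)) / 2)"
    using sx sy by (simp add: algebra_simps)
  finally show "(\<Sum>n. norm (f n)) \<le> cosh \<theta> * ((exp (x\<^sup>2) + exp (y\<^sup>2)) / 2)" .
qed

text \<open>With \<open>c = cosh \<theta>\<close> and \<open>s = sinh \<theta>\<close> the
  exponentials are \<open>(c + s)^2\<close> and \<open>(c - s)^2\<close>, and the claim becomes a
  polynomial identity modulo \<open>c^2 = s^2 + 1\<close>.\<close>

lemma parabolic_exponent_split:
  fixes \<xi> \<eta> \<xi>0 \<eta>0 \<theta> :: real
  shows "exp (- (((\<xi> + \<xi>0)\<^sup>2 + (\<eta> + \<eta>0)\<^sup>2) * exp (- 2 * \<theta>) + ((\<xi> - \<xi>0)\<^sup>2 + (\<eta> - \<eta>0)\<^sup>2) * exp (2 * \<theta>)) / 4) =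
    exp ((\<eta>0\<^sup>2 - \<xi>0\<^sup>2 - \<eta>\<^sup>2 - \<xi>\<^sup>2) / 2) *
    (exp (2 * \<xi> * \<xi>0 * (sinh \<theta> * cosh \<theta>) - (\<xi>\<^sup>2 + \<xi>0\<^sup>2) * (sinh \<theta>)\<^sup>2) * parabolic_kernel \<eta> \<eta>0 \<theta>)"
proof -
  define s c where "s = sinh \<theta>" and "c = cosh \<theta>"
  have cs: "c\<^sup>2 = s\<^sup>2 + 1" by (simp add: s_def c_def cosh_square_eq)
  have e: "exp (2 * \<theta>) = (c + s)\<^sup>2" "exp (- 2 * \<theta>) = (c - s)\<^sup>2"
    by (simp_all add: s_def c_def cosh_plus_sinh cosh_minus_sinh exp_double[symmetric] power2_eq_square mult_exp_exp)
  have "- (((\<xi> + \<xi>0)\<^sup>2 + (\<eta> + \<eta>0)\<^sup>2) * (c - s)\<^sup>2 + ((\<xi> - \<xi>0)\<^sup>2 + (\<eta> - \<eta>0)\<^sup>2) * (c + s)\<^sup>2) =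
      4 * ((\<eta>0\<^sup>2 - \<xi>0\<^sup>2 - \<eta>\<^sup>2 - \<xi>\<^sup>2) / 2 + (2 * \<xi> * \<xi>0 * (s * c) - (\<xi>\<^sup>2 + \<xi>0\<^sup>2) * s\<^sup>2 - (\<eta> * s - \<eta>0 * c)\<^sup>2))"
    using cs by (simp add: divide_simps) algebra
  then show ?thesis
    unfolding parabolic_kernel_def s_def[symmetric] c_def[symmetric] e by (simp add: mult_exp_exp)
qed

text \<open>Summability is asserted beside the value because \<open>suminf\<close> also denotes some
  value for a divergent series.\<close>

theorem theorem2p2:
  fixes \<xi> \<eta> \<xi>0 \<eta>0 :: real
  assumes "\<eta> > \<bar>\<eta>0\<bar>"
  defines "a \<equiv> (\<lambda>n::nat.
      (- \<i>) ^ n / (2 powi (int n - 1) * fact n)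
        * hermite_H (of_nat n) (of_real \<xi>) * hermite_H (- of_nat n - 1) (of_real \<eta>)
        * hermite_H (of_nat n) (of_real \<xi>0) * hermite_H (of_nat n) (\<i> * of_real \<eta>0))"
  shows "summable a \<and>
    complex_of_real (bessel_K0 (parabolic_r \<xi> \<eta> \<xi>0 \<eta>0)) =
      of_real (sqrt pi * exp ((\<eta>0\<^sup>2 - \<xi>0\<^sup>2 - \<eta>\<^sup>2 - \<xi>\<^sup>2) / 2)) * (\<Sum>n. a n)"
proof -
  let ?h = "hermite_coeff (-1) :: nat \<Rightarrow> real \<Rightarrow> real"
  let ?E = "exp ((\<eta>0\<^sup>2 - \<xi>0\<^sup>2 - \<eta>\<^sup>2 - \<xi>\<^sup>2) / 2)"
  let ?A = "(\<xi> + \<xi>0)\<^sup>2 + (\<eta> + \<eta>0)\<^sup>2" and ?B = "(\<xi> - \<xi>0)\<^sup>2 + (\<eta> - \<eta>0)\<^sup>2"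
  let ?G = "\<lambda>\<theta>. exp (- (?A * exp (- 2 * \<theta>) + ?B * exp (2 * \<theta>)) / 4)"
  let ?M = "\<lambda>n \<theta>. fact n * ?h n \<xi> * ?h n \<xi>0 * (tanh \<theta> / 2) ^ n"
  let ?k = "\<lambda>\<theta>. parabolic_kernel \<eta> \<eta>0 \<theta> / cosh \<theta>"
  let ?f = "\<lambda>n \<theta>. ?M n \<theta> * ?k \<theta>"
  \<comment> \<open>The real form of the series terms: the three factors \<open>n!\<close> from the
    polynomials, against \<open>n!\<close> in the denominator and \<open>n!\<close> from the
    negative order, leave a single \<open>n!\<close>.\<close>
  define b where "b n = fact n * ?h n \<xi> * ?h n \<xi>0 * hermite_coeff 1 n \<eta>0 * half_gaussian_moment n \<eta> * 2 / 2 ^ n" for n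
  have k: "?k \<theta> \<ge> 0" for \<theta> by (simp add: parabolic_kernel_def)
  have norm_f: "norm (?f n \<theta>) = norm (?M n \<theta>) * ?k \<theta>" for n \<theta>
    by (simp only: real_norm_def abs_mult[of "?M n \<theta>"] abs_of_nonneg[OF k])
  have m: "?f n \<in> borel_measurable lborel" for n by measurable
  have w: "integrable lborel (\<lambda>\<theta>. (exp (\<xi>\<^sup>2) + exp (\<xi>0\<^sup>2)) / 2 * parabolic_kernel \<eta> \<eta>0 \<theta>)"
    by (intro integrable_mult_right parabolic_kernel_integrable assms)
  have s: "summable (\<lambda>n. norm (?f n \<theta>))" for \<theta>
    unfolding norm_f by (intro summable_mult2 mehler_tanh_norm_summable)
  have l: "(\<Sum>n. norm (?f n \<theta>)) \<le> (exp (\<xi>\<^sup>2) + exp (\<xi>0\<^sup>2)) / 2 * parabolic_kernel \<eta> \<eta>0 \<theta>" for \<theta>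
  proof -
    have "(\<Sum>n. norm (?f n \<theta>)) = (\<Sum>n. norm (?M n \<theta>)) * ?k \<theta>"
      unfolding norm_f by (intro suminf_mult2[symmetric] mehler_tanh_norm_summable)
    also have "\<dots> \<le> (cosh \<theta> * ((exp (\<xi>\<^sup>2) + exp (\<xi>0\<^sup>2)) / 2)) * ?k \<theta>"
      by (intro mult_right_mono mehler_tanh_norm_suminf_le k)
    finally show ?thesis by simp
  qed
  note dom = m w s l
  have G: "?G \<theta> = ?E * (\<Sum>n. ?f n \<theta>)" for \<theta>
  proof -
    have "(\<Sum>n. ?f n \<theta>) = (cosh \<theta> * exp (2 * \<xi> * \<xi>0 * (sinh \<theta> * cosh \<theta>) - (\<xi>\<^sup>2 + \<xi>0\<^sup>2) * (sinh \<theta>)\<^sup>2)) * ?k \<theta>"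
      by (intro sums_unique[symmetric] sums_mult2 mehler_tanh)
    then show ?thesis unfolding parabolic_exponent_split by simp
  qed
  \<comment> \<open>The hypothesis makes both \<open>\<eta> + \<eta>0\<close> and
    \<open>\<eta> - \<eta>0\<close> positive, so neither distance degenerates.\<close>
  have AB: "?A > 0" "?B > 0" using assms(1) by (auto intro!: add_nonneg_pos)
  have int: "integrable lborel ?G"
    unfolding G by (intro integrable_mult_right dominated_series_integrable_suminf[OF dom])
  have r: "parabolic_r \<xi> \<eta> \<xi>0 \<eta>0 = sqrt (?A * ?B) / 2"
    unfolding parabolic_r_def by (simp add: real_sqrt_mult real_sqrt_divide)
  have "bessel_K0 (parabolic_r \<xi> \<eta> \<xi>0 \<eta>0) = (\<integral>\<theta>. ?G \<theta> \<partial>lborel)"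
    unfolding r by (rule bessel_K0_eq_integral[OF AB int])
  also have "\<dots> = ?E * (\<integral>\<theta>. (\<Sum>n. ?f n \<theta>) \<partial>lborel)"
    unfolding G by (rule integral_mult_right_zero)
  finally have K0: "bessel_K0 (parabolic_r \<xi> \<eta> \<xi>0 \<eta>0) = ?E * (\<integral>\<theta>. (\<Sum>n. ?f n \<theta>) \<partial>lborel)" .
  have "integral\<^sup>L lborel (?f n) = sqrt pi * b n" for n
  proof -
    have f_eq: "?f n = (\<lambda>\<theta>. (fact n * ?h n \<xi> * ?h n \<xi>0 / 2 ^ n) * (tanh \<theta> ^ n * ?k \<theta>))"
      by (simp add: fun_eq_iff power_divide)
    show ?thesis
      unfolding f_eq integral_mult_right_zero parabolic_kernel_moment[OF assms(1)] b_def by simp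
  qed
  with dominated_series_sums[OF dom] have "(\<lambda>n. sqrt pi * b n) sums (\<integral>\<theta>. (\<Sum>n. ?f n \<theta>) \<partial>lborel)"
    by simp
  from sums_divide[OF this, of "sqrt pi"]
  have b: "b sums ((\<integral>\<theta>. (\<Sum>n. ?f n \<theta>) \<partial>lborel) / sqrt pi)" by simp
  have "a = (\<lambda>n. of_real (b n))"
  proof
    fix n
    \<comment> \<open>The exponent is an integer, so \<open>n = 0\<close> gives 1/2 and the
      rewriting as \<open>2^n / 2\<close> covers every \<open>n\<close>.\<close>
    have p: "(2::complex) powi (int n - 1) = 2 ^ n / 2"
      by (simp add: power_int_diff)
    have "a n = (- \<i>) ^ n * hermite_coeff (-1) n (\<i> * of_real \<eta>0) *
        of_real (fact n * ?h n \<xi> * ?h n \<xi>0 * half_gaussian_moment n \<eta> * 2 / 2 ^ n)"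
      using hermite_coeff_of_real[of "-1" n \<xi>, where 'a=complex] hermite_coeff_of_real[of "-1" n \<xi>0, where 'a=complex]
      unfolding a_def p hermite_H_of_nat hermite_H_neg_of_nat by (simp add: field_simps)
    also have "\<dots> = of_real (b n)"
      unfolding hermite_coeff_imaginary b_def by simp
    finally show "a n = of_real (b n)" .
  qed
  then have "a sums of_real ((\<integral>\<theta>. (\<Sum>n. ?f n \<theta>) \<partial>lborel) / sqrt pi)"
    using b by (simp only: sums_of_real_iff)
  then show ?thesis
    by (simp add: K0 sums_iff)
qed

end
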